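(* Let $X$ be the space of all convergent sequences $(a_n)_{n\in\mathbb N}$ of real numbers such that $$\lim_{j\to\infty} a_j=\sum_{n=1}^\infty \frac{a_n}{2^n},$$ with the supremum norm. Then $X$ is isomorphic to $c_0$, the dual $X^*$ is isometric to $\ell_1$ (the evaluation functionals $e_n((a_j)_j)=a_n$, $n\in\mathbb N$, form a basis of $X^*$ which is isometrically (1-)equivalent to the usual unit vector basis of $\ell_1$), and $X$ is not isometric to a quotient of $C(K)$ for any countable compact metric space $K$. In particular, $X$ is not isometric to a quotient of $C(\alpha)$ for any countable ordinal $\alpha$.
   Context: $\mathbb N=\{1,2,3,\dots\}$. For a compact space $K$, $C(K)$ is the Banach space of real-valued continuous functions on $K$ with the supremum norm. For an ordinal $\alpha$, $C(\alpha)$ denotes the space of continuous functions on the set of ordinals less than or equal to $\alpha$ with the order topology. A quotient of a Banach space $Z$ is a space $Z/Y$ with $Y$ a closed subspace of $Z$, with the quotient norm. "Isometric" means linearly isometric (onto). *)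

theory Defs
  imports "HOL-Analysis.Analysis" "HOL-Library.Set_Algebras" "HOL-Probability.Discrete_Topology"
begin

section \<open>The sequence spaces\<close>

text \<open>
  Sequences are indexed by \<open>nat\<close>, so the entry with index \<open>n\<close> here is the
  entry with index \<open>n + 1\<close> of a sequence indexed by \<open>{1, 2, 3, \<dots>}\<close>; accordingly its weight
  is \<open>1 / 2 ^ (n + 1)\<close>.  As \<open>nat\<close> is discrete, \<open>nat \<Rightarrow>\<^sub>C real\<close> is the space of all bounded
  sequences with the supremum norm.  Convergent sequences are bounded, so no sequence is lost
  by carving \<open>X\<close> and \<open>c0\<close> out of it.
\<close>

lemma summable_weighted:
  fixes a :: "nat \<Rightarrow>\<^sub>C real"
  shows "summable (\<lambda>n. apply_bcontfun a n / 2 ^ (n + 1))"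
proof (rule summable_comparison_test')
  show "summable (\<lambda>n. norm a * (1 / 2) ^ (n + 1))"
    by (intro summable_mult summable_ignore_initial_segment summable_geometric) simp
  show "norm (apply_bcontfun a n / 2 ^ (n + 1)) \<le> norm a * (1 / 2) ^ (n + 1)" if "n \<ge> 0" for n
    using norm_bounded[of a n] by (simp add: power_divide divide_simps)
qed

definition X_seqs :: "(nat \<Rightarrow>\<^sub>C real) set" where
  "X_seqs = {a. convergent (apply_bcontfun a) \<and>
                lim (apply_bcontfun a) = (\<Sum>n. apply_bcontfun a n / 2 ^ (n + 1))}"

definition c0_seqs :: "(nat \<Rightarrow>\<^sub>C real) set" where
  "c0_seqs = {a. apply_bcontfun a \<longlonglongrightarrow> 0}"

lemma X_seqs_iff:
  "a \<in> X_seqs \<longleftrightarrow> apply_bcontfun a \<longlonglongrightarrow> (\<Sum>n. apply_bcontfun a n / 2 ^ (n + 1))"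
  unfolding X_seqs_def
  by (auto simp: convergent_LIMSEQ_iff convergentI limI)

lemma subspace_X_seqs: "subspace X_seqs"
  unfolding subspace_def
proof (intro conjI ballI allI)
  show "0 \<in> X_seqs"
    by (simp add: X_seqs_iff)
  fix a assume a: "a \<in> X_seqs"
  show "a + b \<in> X_seqs" if b: "b \<in> X_seqs" for b
    using tendsto_add[OF a[unfolded X_seqs_iff] b[unfolded X_seqs_iff]]
    by (simp add: X_seqs_iff plus_bcontfun.rep_eq add_divide_distrib
        suminf_add[OF summable_weighted summable_weighted, simplified])
  show "c *\<^sub>R a \<in> X_seqs" for c
    using tendsto_mult_left[OF a[unfolded X_seqs_iff], of c]
    by (simp add: X_seqs_iff scaleR_bcontfun.rep_eq
        suminf_mult[OF summable_weighted, simplified])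
qed

lemma subspace_c0_seqs: "subspace c0_seqs"
  unfolding subspace_def c0_seqs_def
  by (auto simp: plus_bcontfun.rep_eq scaleR_bcontfun.rep_eq
      intro: tendsto_add_zero tendsto_mult_right_zero)

typedef X = X_seqs
  using subspace_0[OF subspace_X_seqs] by blast

typedef c0 = c0_seqs
  using subspace_0[OF subspace_c0_seqs] by blast

typedef ell1 = "{a :: nat \<Rightarrow> real. summable (\<lambda>n. \<bar>a n\<bar>)}"
  by (rule exI[of _ "\<lambda>_. 0"]) simp

setup_lifting type_definition_X
setup_lifting type_definition_c0
setup_lifting type_definition_ell1

instantiation X :: real_normed_vector
begin

lift_definition zero_X :: X is 0 by (rule subspace_0[OF subspace_X_seqs])
lift_definition plus_X :: "X \<Rightarrow> X \<Rightarrow> X" is "(+)" by (rule subspace_add[OF subspace_X_seqs])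
lift_definition minus_X :: "X \<Rightarrow> X \<Rightarrow> X" is "(-)" by (rule subspace_diff[OF subspace_X_seqs])
lift_definition uminus_X :: "X \<Rightarrow> X" is uminus by (rule subspace_neg[OF subspace_X_seqs])
lift_definition scaleR_X :: "real \<Rightarrow> X \<Rightarrow> X" is scaleR by (rule subspace_scale[OF subspace_X_seqs])
lift_definition norm_X :: "X \<Rightarrow> real" is norm .
definition dist_X :: "X \<Rightarrow> X \<Rightarrow> real" where "dist_X x y = norm (x - y)"
definition sgn_X :: "X \<Rightarrow> X" where "sgn_X x = inverse (norm x) *\<^sub>R x"
definition uniformity_X :: "(X \<times> X) filter"
  where "uniformity_X = (INF e\<in>{0<..}. principal {(x, y). dist x y < e})"
definition open_X :: "X set \<Rightarrow> bool"
  where "open_X U = (\<forall>x\<in>U. \<forall>\<^sub>F (x', y) in uniformity. x' = x \<longrightarrow> y \<in> U)"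

instance
proof
  show "norm (x + y) \<le> norm x + norm y" for x y :: X
    by transfer (rule norm_triangle_ineq)
qed (rule dist_X_def sgn_X_def uniformity_X_def open_X_def |
     transfer, simp add: algebra_simps)+

end

instantiation c0 :: real_normed_vector
begin

lift_definition zero_c0 :: c0 is 0 by (rule subspace_0[OF subspace_c0_seqs])
lift_definition plus_c0 :: "c0 \<Rightarrow> c0 \<Rightarrow> c0" is "(+)" by (rule subspace_add[OF subspace_c0_seqs])
lift_definition minus_c0 :: "c0 \<Rightarrow> c0 \<Rightarrow> c0" is "(-)" by (rule subspace_diff[OF subspace_c0_seqs])
lift_definition uminus_c0 :: "c0 \<Rightarrow> c0" is uminus by (rule subspace_neg[OF subspace_c0_seqs])
lift_definition scaleR_c0 :: "real \<Rightarrow> c0 \<Rightarrow> c0" is scaleR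
  by (rule subspace_scale[OF subspace_c0_seqs])
lift_definition norm_c0 :: "c0 \<Rightarrow> real" is norm .
definition dist_c0 :: "c0 \<Rightarrow> c0 \<Rightarrow> real" where "dist_c0 x y = norm (x - y)"
definition sgn_c0 :: "c0 \<Rightarrow> c0" where "sgn_c0 x = inverse (norm x) *\<^sub>R x"
definition uniformity_c0 :: "(c0 \<times> c0) filter"
  where "uniformity_c0 = (INF e\<in>{0<..}. principal {(x, y). dist x y < e})"
definition open_c0 :: "c0 set \<Rightarrow> bool"
  where "open_c0 U = (\<forall>x\<in>U. \<forall>\<^sub>F (x', y) in uniformity. x' = x \<longrightarrow> y \<in> U)"

instance
proof
  show "norm (x + y) \<le> norm x + norm y" for x y :: c0
    by transfer (rule norm_triangle_ineq)
qed (rule dist_c0_def sgn_c0_def uniformity_c0_def open_c0_def |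
     transfer, simp add: algebra_simps)+

end

lemma summable_abs_add:
  fixes a b :: "nat \<Rightarrow> real"
  assumes "summable (\<lambda>n. \<bar>a n\<bar>)" "summable (\<lambda>n. \<bar>b n\<bar>)"
  shows "summable (\<lambda>n. \<bar>a n + b n\<bar>)"
  by (rule summable_comparison_test'[OF summable_add[OF assms], of 0]) auto

instantiation ell1 :: real_normed_vector
begin

lift_definition zero_ell1 :: ell1 is "\<lambda>_. 0" by simp
lift_definition plus_ell1 :: "ell1 \<Rightarrow> ell1 \<Rightarrow> ell1" is "\<lambda>a b n. a n + b n"
  by (rule summable_abs_add)
lift_definition minus_ell1 :: "ell1 \<Rightarrow> ell1 \<Rightarrow> ell1" is "\<lambda>a b n. a n - b n"
proof -
  fix a b :: "nat \<Rightarrow> real"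
  assume "summable (\<lambda>n. \<bar>a n\<bar>)" "summable (\<lambda>n. \<bar>b n\<bar>)"
  then show "summable (\<lambda>n. \<bar>a n - b n\<bar>)"
    using summable_abs_add[of a "\<lambda>n. - b n"] by simp
qed
lift_definition uminus_ell1 :: "ell1 \<Rightarrow> ell1" is "\<lambda>a n. - a n" by simp
lift_definition scaleR_ell1 :: "real \<Rightarrow> ell1 \<Rightarrow> ell1" is "\<lambda>c a n. c * a n"
  by (simp add: abs_mult summable_mult)
lift_definition norm_ell1 :: "ell1 \<Rightarrow> real" is "\<lambda>a. \<Sum>n. \<bar>a n\<bar>" .
definition dist_ell1 :: "ell1 \<Rightarrow> ell1 \<Rightarrow> real" where "dist_ell1 x y = norm (x - y)"
definition sgn_ell1 :: "ell1 \<Rightarrow> ell1" where "sgn_ell1 x = inverse (norm x) *\<^sub>R x"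
definition uniformity_ell1 :: "(ell1 \<times> ell1) filter"
  where "uniformity_ell1 = (INF e\<in>{0<..}. principal {(x, y). dist x y < e})"
definition open_ell1 :: "ell1 set \<Rightarrow> bool"
  where "open_ell1 U = (\<forall>x\<in>U. \<forall>\<^sub>F (x', y) in uniformity. x' = x \<longrightarrow> y \<in> U)"

instance
proof
  show "norm (x + y) \<le> norm x + norm y" for x y :: ell1
  proof transfer
    fix a b :: "nat \<Rightarrow> real"
    assume ab: "summable (\<lambda>n. \<bar>a n\<bar>)" "summable (\<lambda>n. \<bar>b n\<bar>)"
    have "(\<Sum>n. \<bar>a n + b n\<bar>) \<le> (\<Sum>n. \<bar>a n\<bar> + \<bar>b n\<bar>)"
      by (intro suminf_le summable_abs_add summable_add ab) simp
    also have "\<dots> = (\<Sum>n. \<bar>a n\<bar>) + (\<Sum>n. \<bar>b n\<bar>)"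
      by (intro suminf_add[symmetric] ab)
    finally show "(\<Sum>n. \<bar>a n + b n\<bar>) \<le> (\<Sum>n. \<bar>a n\<bar>) + (\<Sum>n. \<bar>b n\<bar>)" .
  qed
  show "norm x = 0 \<longleftrightarrow> x = 0" for x :: ell1
    by transfer (simp add: suminf_eq_zero_iff fun_eq_iff)
  show "norm (c *\<^sub>R x) = \<bar>c\<bar> * norm x" for c and x :: ell1
    by transfer (simp add: abs_mult suminf_mult)
qed (rule dist_ell1_def sgn_ell1_def uniformity_ell1_def open_ell1_def |
     transfer, simp add: algebra_simps)+

end

lift_definition unit_vec :: "nat \<Rightarrow> ell1" is "\<lambda>n k. if k = n then 1 else 0"
  by (rule summable_finite[of "{_}"]) auto

lift_definition entry :: "X \<Rightarrow> nat \<Rightarrow> real" is apply_bcontfun .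

text \<open>The dual of \<open>X\<close> is \<open>X \<Rightarrow>\<^sub>L real\<close>, with the operator norm.\<close>

lift_definition eval_functional :: "nat \<Rightarrow> X \<Rightarrow>\<^sub>L real" is "\<lambda>n x. entry x n"
proof (rule bounded_linear_intro[where K = 1])
  fix n x y c
  show "entry (x + y) n = entry x n + entry y n"
    by transfer (simp add: plus_bcontfun.rep_eq)
  show "entry (c *\<^sub>R x) n = c *\<^sub>R entry x n"
    by transfer (simp add: scaleR_bcontfun.rep_eq)
  show "norm (entry x n) \<le> norm x * 1"
    by transfer (simp only: mult_1_right norm_bounded)
qed

section \<open>Isomorphisms, isometries, bases\<close>

definition isomorphism :: "('a::real_normed_vector \<Rightarrow> 'b::real_normed_vector) \<Rightarrow> bool" where
  "isomorphism T \<longleftrightarrow> bij T \<and> bounded_linear T \<and> bounded_linear (inv T)"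

definition linear_isometry_onto :: "('a::real_normed_vector \<Rightarrow> 'b::real_normed_vector) \<Rightarrow> bool" where
  "linear_isometry_onto T \<longleftrightarrow> linear T \<and> (\<forall>x. norm (T x) = norm x) \<and> surj T"

definition schauder_basis :: "(nat \<Rightarrow> 'a::real_normed_vector) \<Rightarrow> bool" where
  "schauder_basis b \<longleftrightarrow> (\<forall>x. \<exists>!c :: nat \<Rightarrow> real. (\<lambda>n. c n *\<^sub>R b n) sums x)"

definition isometrically_equivalent ::
    "(nat \<Rightarrow> 'a::real_normed_vector) \<Rightarrow> (nat \<Rightarrow> 'b::real_normed_vector) \<Rightarrow> bool" where
  "isometrically_equivalent b d \<longleftrightarrow>
     (\<forall>(c :: nat \<Rightarrow> real) N. norm (\<Sum>n<N. c n *\<^sub>R b n) = norm (\<Sum>n<N. c n *\<^sub>R d n))"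

section \<open>Quotients\<close>

text \<open>
  Here \<open>Z\<close> is a linear subspace of an ambient normed space and is itself regarded as a normed
  space.  The points of the quotient \<open>Z / Y\<close> are the cosets \<open>z +o Y\<close>; they are added as sets.
\<close>

definition closed_subspace_of :: "'z::real_normed_vector set \<Rightarrow> 'z set \<Rightarrow> bool" where
  "closed_subspace_of Y Z \<longleftrightarrow> subspace Y \<and> closedin (top_of_set Z) Y"

definition cosets :: "'z::real_normed_vector set \<Rightarrow> 'z set \<Rightarrow> 'z set set" where
  "cosets Z Y = (\<lambda>z. z +o Y) ` Z"

text \<open>Adding \<open>Y\<close> only matters for \<open>c = 0\<close>.\<close>

definition coset_scale :: "'z::real_normed_vector set \<Rightarrow> real \<Rightarrow> 'z set \<Rightarrow> 'z set" where
  "coset_scale Y c A = (\<lambda>a. c *\<^sub>R a) ` A + Y"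

definition quotient_norm :: "'z::real_normed_vector set \<Rightarrow> real" where
  "quotient_norm A = (INF a\<in>A. norm a)"

definition isometry_onto_quotient ::
    "('x::real_normed_vector \<Rightarrow> 'z::real_normed_vector set) \<Rightarrow> 'z set \<Rightarrow> 'z set \<Rightarrow> bool" where
  "isometry_onto_quotient T Z Y \<longleftrightarrow>
     range T = cosets Z Y \<and>
     (\<forall>x y. T (x + y) = T x + T y) \<and>
     (\<forall>c x. T (c *\<^sub>R x) = coset_scale Y c (T x)) \<and>
     (\<forall>x. quotient_norm (T x) = norm x)"

definition isometric_to_quotient_of ::
    "'x::real_normed_vector itself \<Rightarrow> 'z::real_normed_vector set \<Rightarrow> bool" where
  "isometric_to_quotient_of _ Z \<longleftrightarrow>
     (\<exists>Y (T :: 'x \<Rightarrow> 'z set). closed_subspace_of Y Z \<and> isometry_onto_quotient T Z Y)"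

section \<open>Spaces of continuous functions\<close>

text \<open>
  \<open>'k discrete \<Rightarrow>\<^sub>C real\<close> is the Banach space of all bounded real functions on the type \<open>'k\<close> with the
  supremum norm, \<open>'k discrete\<close> being a copy of \<open>'k\<close> with the discrete topology.  A
  continuous function on a compact space \<open>K\<close> is bounded and is represented by its extension by
  \<open>0\<close> to the whole type, which does not change the supremum norm.
\<close>

definition C_space :: "'k topology \<Rightarrow> ('k discrete \<Rightarrow>\<^sub>C real) set" where
  "C_space K = {f. continuous_map K euclideanreal (\<lambda>x. apply_bcontfun f (discrete x)) \<and>
                   (\<forall>x. x \<notin> topspace K \<longrightarrow> apply_bcontfun f (discrete x) = 0)}"

definition order_topology_on :: "'a::order set \<Rightarrow> 'a topology" where
  "order_topology_on S = topology_generated_by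
     ({S} \<union> (\<lambda>a. {x \<in> S. x < a}) ` S \<union> (\<lambda>a. {x \<in> S. a < x}) ` S)"

text \<open>
  An ordinal \<open>\<alpha>\<close> is given by a well-order \<open>r\<close> of order type \<open>\<alpha>\<close>.  Mapping an initial segment
  (\<open>ofilter\<close>) of \<open>r\<close> to its order type is an order isomorphism from the initial segments, ordered
  by inclusion, onto the ordinals \<open>\<le> \<alpha>\<close>; the segment \<open>Field r\<close> corresponds to \<open>\<alpha>\<close> itself.
\<close>

definition ordinals_upto :: "'o rel \<Rightarrow> 'o set topology" where
  "ordinals_upto r = order_topology_on {A. Order_Relation.ofilter r A}"

end

theory Submission
  imports Defs
begin

text \<open>
  The space \<open>X\<close> is a hyperplane in the space of convergent sequences, and such hyperplanes are
  isomorphic to \<open>c0\<close>: replacing the entries of \<open>x\<close> by their differences from the limit, and the first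
  one by the limit itself, loses nothing, because the defining equation of \<open>X\<close> determines the first entry
  (\<open>isomorphism_to_c0\<close>).

  Any finite prefix with values in \<open>[-1, 1]\<close> extends to an element of the unit ball of \<open>X\<close>, by a
  constant that is a weighted average of the prefix (\<open>X_extending_prefix\<close>).  Testing on such elements
  shows that the evaluation functionals span \<open>l_1\<close> isometrically.  They span the whole dual, because
  the functionals on \<open>c0\<close> are absolutely summable sequences and the one extra functional \<open>x \<mapsto> lim x\<close> is on
  \<open>X\<close> the norm convergent series \<open>\<Sum>n. e n / 2 ^ (n + 1)\<close> (\<open>eval_expansion_exists\<close>).

  Suppose that \<open>q\<close> maps \<open>C(K)\<close> onto \<open>X\<close> as a quotient map, with \<open>K\<close> countable and compact.  The adjoint embeds
  the dual of \<open>X\<close> isometrically into \<open>C(K)*\<close>, which is \<open>l_1(K)\<close> by countability (\<open>representation\<close>).  Isometric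
  copies of the unit vector basis in \<open>l_1(K)\<close> have disjoint supports.  But \<open>K\<close> is scattered
  (\<open>exists_isolated_point\<close>), so some point \<open>x\<close> of the union of these supports is isolated in it.  The
  indicator of a clopen set isolating \<open>x\<close> is seen by exactly one of the functionals \<open>e n \<circ> q\<close>, so that
  \<open>e n \<circ> q\<close> tends to \<open>0\<close> there, whereas \<open>\<Sum>n. (e n \<circ> q) / 2 ^ (n + 1)\<close>, which ought to be the limit, does not vanish
  (\<open>X_not_isometric_to_quotient\<close>).  The ordinals up to a countable ordinal form a countable compact Hausdorff space
  (\<open>countable_compact_ordinals_upto\<close>), so they are covered by the same argument.
\<close>

section \<open>An isomorphism onto the space of null sequences\<close>

lemma convergent_bcontfun:
  fixes s :: "nat \<Rightarrow> real"
  assumes "convergent s"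
  shows "s \<in> bcontfun"
  using convergent_imp_bounded[of s] assms by (auto simp: bcontfun_def convergent_def)

lemma entry_tendsto: "entry x \<longlonglongrightarrow> (\<Sum>n. entry x n / 2 ^ (n + 1))"
  by transfer (simp add: X_seqs_iff)

lemma entry_summable: "summable (\<lambda>n. entry x n / 2 ^ (n + 1))"
  by transfer (rule summable_weighted)

lemma abs_entry_le: "\<bar>entry x n\<bar> \<le> norm x"
  by transfer (metis norm_bounded real_norm_def)

lemma norm_X_le: "(\<And>n. \<bar>entry x n\<bar> \<le> B) \<Longrightarrow> norm x \<le> B"
  by transfer (auto intro: norm_bound)

lemma entry_eqI: "(\<And>n. entry x n = entry y n) \<Longrightarrow> x = y"
  by transfer (rule bcontfun_eqI)

lemma entry_add [simp]: "entry (x + y) n = entry x n + entry y n"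
  by transfer (simp add: plus_bcontfun.rep_eq)

lemma entry_scaleR [simp]: "entry (c *\<^sub>R x) n = c * entry x n"
  by transfer (simp add: scaleR_bcontfun.rep_eq)

lemma X_of_sequence:
  assumes "s \<longlonglongrightarrow> (\<Sum>n. s n / 2 ^ (n + 1))"
  obtains x where "entry x = s"
proof -
  have b: "s \<in> bcontfun"
    using assms by (intro convergent_bcontfun) (auto simp: convergent_def)
  with assms have "Bcontfun s \<in> X_seqs"
    by (simp add: X_seqs_iff Bcontfun_inverse)
  then have "entry (Abs_X (Bcontfun s)) = s"
    using b by (simp add: entry.rep_eq Abs_X_inverse Bcontfun_inverse)
  then show ?thesis ..
qed

lift_definition c0_entry :: "c0 \<Rightarrow> nat \<Rightarrow> real" is apply_bcontfun .

lemma c0_entry_tendsto: "c0_entry c \<longlonglongrightarrow> 0"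
  by transfer (simp add: c0_seqs_def)

lemma abs_c0_entry_le: "\<bar>c0_entry c n\<bar> \<le> norm c"
  by transfer (metis norm_bounded real_norm_def)

lemma norm_c0_le: "(\<And>n. \<bar>c0_entry c n\<bar> \<le> B) \<Longrightarrow> norm c \<le> B"
  by transfer (auto intro: norm_bound)

lemma c0_entry_eqI: "(\<And>n. c0_entry c n = c0_entry d n) \<Longrightarrow> c = d"
  by transfer (rule bcontfun_eqI)

lemma c0_entry_add [simp]: "c0_entry (c + d) n = c0_entry c n + c0_entry d n"
  by transfer (simp add: plus_bcontfun.rep_eq)

lemma c0_entry_diff [simp]: "c0_entry (c - d) n = c0_entry c n - c0_entry d n"
  by transfer (simp add: minus_bcontfun.rep_eq)

lemma c0_entry_scaleR [simp]: "c0_entry (t *\<^sub>R c) n = t * c0_entry c n"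
  by transfer (simp add: scaleR_bcontfun.rep_eq)

lemma c0_entry_0 [simp]: "c0_entry 0 n = 0"
  using c0_entry_scaleR[of 0 0 n] by simp

lemma c0_entry_sum [simp]: "c0_entry (\<Sum>i\<in>I. f i) n = (\<Sum>i\<in>I. c0_entry (f i) n)"
  by (induction I rule: infinite_finite_induct) auto

lemma c0_of_sequence:
  assumes "s \<longlonglongrightarrow> 0"
  obtains c where "c0_entry c = s"
proof -
  have b: "s \<in> bcontfun"
    using assms by (intro convergent_bcontfun) (auto simp: convergent_def)
  with assms have "Bcontfun s \<in> c0_seqs"
    by (simp add: c0_seqs_def Bcontfun_inverse)
  then have "c0_entry (Abs_c0 (Bcontfun s)) = s"
    using b by (simp add: c0_entry.rep_eq Abs_c0_inverse Bcontfun_inverse)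
  then show ?thesis ..
qed

text \<open>A sequence in \<open>X\<close> is recovered from its limit and all entries but the first, and these can
  be prescribed freely; so the limit is stored in the vacant first place.  Subtracting it
  elsewhere makes the result a null sequence.\<close>

definition to_c0 :: "X \<Rightarrow> c0" where
  "to_c0 x = (SOME c. c0_entry c =
     (\<lambda>n. case n of 0 \<Rightarrow> lim (entry x) | Suc k \<Rightarrow> entry x (Suc k) - lim (entry x)))"

lemma to_c0_entry:
  "c0_entry (to_c0 x) 0 = lim (entry x)"
  "c0_entry (to_c0 x) (Suc k) = entry x (Suc k) - lim (entry x)"
proof -
  let ?s = "\<lambda>n. case n of 0 \<Rightarrow> lim (entry x) | Suc k \<Rightarrow> entry x (Suc k) - lim (entry x)"
  have "entry x \<longlonglongrightarrow> lim (entry x)"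
    using entry_tendsto[of x] limI by metis
  from tendsto_diff[OF LIMSEQ_Suc[OF this] tendsto_const[of "lim (entry x)"]]
  have "(\<lambda>k. ?s (Suc k)) \<longlonglongrightarrow> 0"
    by simp
  then have "?s \<longlonglongrightarrow> 0"
    by (rule LIMSEQ_imp_Suc)
  then obtain c where "c0_entry c = ?s"
    using c0_of_sequence by blast
  then have "c0_entry (to_c0 x) = ?s"
    unfolding to_c0_def by (rule someI)
  then show "c0_entry (to_c0 x) 0 = lim (entry x)"
      "c0_entry (to_c0 x) (Suc k) = entry x (Suc k) - lim (entry x)"
    by simp_all
qed

lemma entry_lim: "entry x \<longlonglongrightarrow> lim (entry x)" "lim (entry x) = (\<Sum>n. entry x n / 2 ^ (n + 1))"
  using entry_tendsto[of x] limI by metis+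

lemma abs_lim_le: "\<bar>lim (entry x)\<bar> \<le> norm x"
proof (rule LIMSEQ_le_const2)
  show "(\<lambda>n. \<bar>entry x n\<bar>) \<longlonglongrightarrow> \<bar>lim (entry x)\<bar>"
    by (intro tendsto_rabs entry_lim)
qed (use abs_entry_le in blast)

lemma weights_sums: "(\<lambda>n. L / 2 ^ (n + 1)) sums (L :: real)"
  using sums_mult[OF power_half_series, of L] by (simp add: power_divide)

lemma weight_tail_sums: "(\<lambda>k. L / 2 ^ (Suc k + 1)) sums (L / 2 :: real)"
  using sums_mult[OF weights_sums[of L], of "1/2"] by (simp add: field_simps)

text \<open>The entry with index \<open>0\<close> is determined by the limit and the other entries.\<close>

text \<open>This is the equation defining \<open>X\<close>, solved for the first entry; it bounds that entry by the
  limit and the other entries and so makes the inverse of \<open>to_c0\<close> bounded.\<close>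

lemma entry_0_eq: "entry x 0 = 2 * (lim (entry x) - (\<Sum>k. entry x (Suc k) / 2 ^ (Suc k + 1)))"
  using suminf_split_head[OF entry_summable[of x]] entry_lim(2)[of x] by simp

lemma bounded_linear_to_c0: "bounded_linear to_c0"
proof (rule bounded_linear_intro[where K = 2])
  have lim_add: "lim (entry (x + y)) = lim (entry x) + lim (entry y)" for x y
    using tendsto_add[OF entry_lim(1)[of x] entry_lim(1)[of y]]
    by (intro limI) (simp flip: entry_add)
  have lim_scale: "lim (entry (c *\<^sub>R x)) = c * lim (entry x)" for c x
    using tendsto_mult_left[OF entry_lim(1)[of x], of c] by (intro limI) (simp flip: entry_scaleR)
  fix x y c
  show "to_c0 (x + y) = to_c0 x + to_c0 y"
  proof (rule c0_entry_eqI)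
    show "c0_entry (to_c0 (x + y)) n = c0_entry (to_c0 x + to_c0 y) n" for n
      by (cases n) (simp_all add: to_c0_entry lim_add)
  qed
  show "to_c0 (c *\<^sub>R x) = c *\<^sub>R to_c0 x"
  proof (rule c0_entry_eqI)
    show "c0_entry (to_c0 (c *\<^sub>R x)) n = c0_entry (c *\<^sub>R to_c0 x) n" for n
      by (cases n) (simp_all add: to_c0_entry lim_scale right_diff_distrib)
  qed
  show "norm (to_c0 x) \<le> norm x * 2"
  proof (rule norm_c0_le)
    show "\<bar>c0_entry (to_c0 x) n\<bar> \<le> norm x * 2" for n
      using abs_lim_le[of x] abs_entry_le[of x n] by (cases n) (auto simp: to_c0_entry)
  qed
qed

lemma X_of_limit_and_tail:
  assumes "(\<lambda>k. s (Suc k)) \<longlonglongrightarrow> L"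
  obtains x where "\<And>k. entry x (Suc k) = s (Suc k)" "lim (entry x) = L"
proof -
  have "summable (\<lambda>k. s (Suc k) / 2 ^ (Suc k + 1))"
  proof -
    obtain B where B: "\<And>k. \<bar>s (Suc k)\<bar> \<le> B"
      using convergent_imp_bounded[OF assms] unfolding bounded_iff real_norm_def by blast
    show ?thesis
    proof (rule summable_comparison_test'[OF sums_summable[OF weight_tail_sums[of B]]])
      show "norm (s (Suc k) / 2 ^ (Suc k + 1)) \<le> B / 2 ^ (Suc k + 1)" for k
        using B[of k] by (simp add: divide_simps)
    qed
  qed
  then obtain D where D: "(\<lambda>k. s (Suc k) / 2 ^ (Suc k + 1)) sums D"
    by (auto simp: summable_def)
  \<comment> \<open>The first entry solves the defining equation of \<open>X\<close> for the prescribed limit.\<close>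
  define u where "u n = (if n = 0 then 2 * (L - D) else s n)" for n
  have "(\<lambda>n. u n / 2 ^ (n + 1)) sums (D + u 0 / 2 ^ (0 + 1))"
    using D by (subst sums_Suc_iff[symmetric]) (simp_all add: u_def)
  moreover have "D + u 0 / 2 ^ (0 + 1) = L"
    by (simp add: u_def field_simps)
  ultimately have "(\<Sum>n. u n / 2 ^ (n + 1)) = L"
    by (simp only: sums_iff)
  moreover have "u \<longlonglongrightarrow> L"
    by (rule LIMSEQ_imp_Suc) (use assms in \<open>simp add: u_def\<close>)
  ultimately obtain x where x: "entry x = u"
    using X_of_sequence[of u] by auto
  then have "lim (entry x) = L"
    using \<open>u \<longlonglongrightarrow> L\<close> limI by blast
  with x that[of x] show ?thesis
    by (simp add: u_def)
qed

lemma bij_to_c0: "bij to_c0"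
proof (rule bijI)
  show "inj to_c0"
  proof (rule injI, rule entry_eqI)
    fix x y n assume xy: "to_c0 x = to_c0 y"
    have lim: "lim (entry x) = lim (entry y)"
      using to_c0_entry(1)[of x] to_c0_entry(1)[of y] xy by simp
    have tail: "entry x (Suc k) = entry y (Suc k)" for k
      using to_c0_entry(2)[of x k] to_c0_entry(2)[of y k] xy lim by simp
    show "entry x n = entry y n"
      using entry_0_eq[of x] entry_0_eq[of y] lim tail by (cases n) simp_all
  qed
  show "surj to_c0"
    unfolding surj_def
  proof
    fix c
    let ?s = "\<lambda>n. c0_entry c n + c0_entry c 0"
    have "(\<lambda>k. ?s (Suc k)) \<longlonglongrightarrow> 0 + c0_entry c 0"
      by (intro tendsto_intros LIMSEQ_Suc c0_entry_tendsto)
    then obtain x where x: "\<And>k. entry x (Suc k) = ?s (Suc k)" "lim (entry x) = c0_entry c 0"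
      using X_of_limit_and_tail[of ?s "c0_entry c 0"] by auto
    have "to_c0 x = c"
    proof (rule c0_entry_eqI)
      show "c0_entry (to_c0 x) n = c0_entry c n" for n
        by (cases n) (simp_all add: to_c0_entry x)
    qed
    then show "\<exists>x. c = to_c0 x"
      by blast
  qed
qed

lemma norm_le_to_c0: "norm x \<le> 4 * norm (to_c0 x)"
proof (rule norm_X_le)
  let ?C = "norm (to_c0 x)"
  have L: "\<bar>lim (entry x)\<bar> \<le> ?C"
    using abs_c0_entry_le[of "to_c0 x" 0] by (simp add: to_c0_entry)
  have tail: "\<bar>entry x (Suc k)\<bar> \<le> 2 * ?C" for k
    using abs_c0_entry_le[of "to_c0 x" "Suc k"] L by (simp add: to_c0_entry)
  have "norm (entry x (Suc k) / 2 ^ (Suc k + 1)) \<le> (2 * ?C) / 2 ^ (Suc k + 1)" for k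
    using divide_right_mono[OF tail[of k], of "2 ^ (Suc k + 1)"] by simp
  note norm_suminf_le[OF this sums_summable[OF weight_tail_sums]]
  moreover have "(\<Sum>k. (2 * ?C) / 2 ^ (Suc k + 1)) = ?C"
    using sums_unique[OF weight_tail_sums[of "2 * ?C"]] by simp
  moreover define D where "D = (\<Sum>k. entry x (Suc k) / 2 ^ (Suc k + 1))"
  ultimately have "\<bar>D\<bar> \<le> ?C"
    by (simp only: real_norm_def)
  then have head: "\<bar>entry x 0\<bar> \<le> 4 * ?C"
    using L unfolding entry_0_eq[of x] D_def[symmetric] by (simp add: abs_le_iff)
  show "\<bar>entry x n\<bar> \<le> 4 * ?C" for n
    using head tail[of "n - 1"] norm_ge_zero[of "to_c0 x"] by (cases n) auto
qed

lemma isomorphism_to_c0: "isomorphism to_c0"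
proof -
  have "bounded_linear (inv to_c0)"
  proof (rule bounded_linear_intro[where K = 4])
    interpret bounded_linear to_c0
      by (rule bounded_linear_to_c0)
    note inverse = bij_to_c0[THEN bij_is_inj, THEN inv_f_f] bij_to_c0[THEN bij_is_surj, THEN surj_f_inv_f]
    fix c d t
    show "inv to_c0 (c + d) = inv to_c0 c + inv to_c0 d"
      using inverse add by metis
    show "inv to_c0 (t *\<^sub>R c) = t *\<^sub>R inv to_c0 c"
      using inverse scaleR by metis
    show "norm (inv to_c0 c) \<le> norm c * 4"
      using norm_le_to_c0[of "inv to_c0 c"] inverse by (simp add: mult.commute)
  qed
  then show ?thesis
    by (simp add: isomorphism_def bij_to_c0 bounded_linear_to_c0)
qed

section \<open>The dual space\<close>

text \<open>A prefix is continued by a constant \<open>L\<close>, which is then the limit.  With \<open>w\<close> the total weight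
  and \<open>S\<close> the weighted sum of the prefix, membership in \<open>X\<close> reads \<open>S + L * (1 - w) = L\<close>, so \<open>L = S / w\<close> is
  a weighted average of the prefix and adds nothing to the norm.\<close>

lemma X_extending_prefix:
  assumes y: "\<And>i. i < N \<Longrightarrow> \<bar>y i\<bar> \<le> 1"
  obtains x where "\<And>i. i < N \<Longrightarrow> entry x i = y i" "norm x \<le> 1"
proof -
  define w where "w = (\<Sum>i<N. 1 / 2 ^ (i + 1) :: real)"
  define S where "S = (\<Sum>i<N. y i / 2 ^ (i + 1))"
  have "\<bar>S\<bar> \<le> (\<Sum>i<N. \<bar>y i / 2 ^ (i + 1)\<bar>)"
    unfolding S_def by (rule sum_abs)
  also have "\<dots> \<le> w"
    unfolding w_def by (intro sum_mono) (use y in \<open>simp add: abs_divide divide_right_mono\<close>)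
  finally have Sw: "\<bar>S\<bar> \<le> w" .
  \<comment> \<open>For \<open>N = 0\<close> this is \<open>0 / 0 = 0\<close>, the right value for an empty prefix.\<close>
  define L where "L = S / w"
  have Lw: "L * w = S" and L: "\<bar>L\<bar> \<le> 1"
    using Sw by (auto simp: L_def abs_divide divide_le_eq)
  define s where "s n = (if n < N then y n else L)" for n
  have "(\<lambda>n. L / 2 ^ (n + 1) + (if n \<in> {..<N} then (y n - L) / 2 ^ (n + 1) else 0)) sums
      (L + (\<Sum>n<N. (y n - L) / 2 ^ (n + 1)))"
    by (intro sums_add weights_sums sums_If_finite_set) simp
  also have "(\<lambda>n. L / 2 ^ (n + 1) + (if n \<in> {..<N} then (y n - L) / 2 ^ (n + 1) else 0)) =
      (\<lambda>n. s n / 2 ^ (n + 1))"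
    by (auto simp: s_def diff_divide_distrib)
  also have "(\<Sum>n<N. (y n - L) / 2 ^ (n + 1)) = S - L * w"
    unfolding S_def w_def by (simp add: diff_divide_distrib sum_subtractf sum_distrib_left)
  finally have "(\<Sum>n. s n / 2 ^ (n + 1)) = L"
    using Lw by (simp add: sums_iff)
  moreover have "s \<longlonglongrightarrow> L"
    by (rule tendsto_eventually, rule eventually_sequentiallyI[of N]) (simp add: s_def)
  ultimately obtain x where x: "entry x = s"
    using X_of_sequence[of s] by auto
  have "norm x \<le> 1"
    using y L by (intro norm_X_le) (simp add: x s_def)
  with that[of x] x show ?thesis
    by (simp add: s_def)
qed

lemma eval_functional_apply [simp]: "blinfun_apply (eval_functional n) x = entry x n"
  by (simp add: eval_functional.rep_eq)

lemma norm_eval_functional_le: "norm (eval_functional n) \<le> 1"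
  by (rule norm_blinfun_bound) (simp_all add: abs_entry_le)

text \<open>The lower bound is attained: some element of the unit ball has the signs of the coefficients
  as its first \<open>N\<close> entries.\<close>

lemma norm_eval_combination: "norm (\<Sum>n<N. c n *\<^sub>R eval_functional n) = (\<Sum>n<N. \<bar>c n\<bar>)"
proof (rule antisym)
  have "norm (\<Sum>n<N. c n *\<^sub>R eval_functional n) \<le> (\<Sum>n<N. norm (c n *\<^sub>R eval_functional n))"
    by (rule norm_sum)
  also have "\<dots> \<le> (\<Sum>n<N. \<bar>c n\<bar>)"
    by (intro sum_mono) (simp add: mult_left_le norm_eval_functional_le)
  finally show "norm (\<Sum>n<N. c n *\<^sub>R eval_functional n) \<le> (\<Sum>n<N. \<bar>c n\<bar>)" .
  have "\<bar>sgn (c i)\<bar> \<le> 1" for i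
    by (simp add: abs_sgn_eq)
  then obtain x where x: "\<And>i. i < N \<Longrightarrow> entry x i = sgn (c i)" "norm x \<le> 1"
    using X_extending_prefix[of N "\<lambda>i. sgn (c i)"] by blast
  have "(\<Sum>n<N. \<bar>c n\<bar>) = blinfun_apply (\<Sum>n<N. c n *\<^sub>R eval_functional n) x"
    by (simp add: blinfun.sum_left blinfun.scaleR_left x(1) abs_sgn)
  also have "\<dots> \<le> norm (\<Sum>n<N. c n *\<^sub>R eval_functional n) * norm x"
    using norm_blinfun[of "\<Sum>n<N. c n *\<^sub>R eval_functional n" x] by simp
  also have "\<dots> \<le> norm (\<Sum>n<N. c n *\<^sub>R eval_functional n)"
    using x(2) by (simp add: mult_left_le)
  finally show "(\<Sum>n<N. \<bar>c n\<bar>) \<le> norm (\<Sum>n<N. c n *\<^sub>R eval_functional n)" .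
qed

lemma Rep_ell1_add: "Rep_ell1 (a + b) n = Rep_ell1 a n + Rep_ell1 b n"
  by transfer simp

lemma Rep_ell1_scaleR: "Rep_ell1 (t *\<^sub>R a) n = t * Rep_ell1 a n"
  by transfer simp

lemma Rep_ell1_unit_combination: "Rep_ell1 (\<Sum>n<N. c n *\<^sub>R unit_vec n) k = (if k < N then c k else 0)"
proof (induction N)
  case 0
  show ?case
    by (simp add: zero_ell1.rep_eq)
next
  case (Suc N)
  then show ?case
    by (auto simp: Rep_ell1_add Rep_ell1_scaleR unit_vec.rep_eq less_Suc_eq)
qed

lemma isometrically_equivalent_eval: "isometrically_equivalent eval_functional unit_vec"
  unfolding isometrically_equivalent_def
proof (intro allI)
  fix c :: "nat \<Rightarrow> real" and N
  have "norm (\<Sum>n<N. c n *\<^sub>R unit_vec n) = (\<Sum>k. \<bar>if k < N then c k else 0\<bar>)"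
    by (simp add: norm_ell1.rep_eq Rep_ell1_unit_combination)
  also have "\<dots> = (\<Sum>k<N. \<bar>if k < N then c k else 0\<bar>)"
    by (rule suminf_finite) auto
  finally show "norm (\<Sum>n<N. c n *\<^sub>R eval_functional n) = norm (\<Sum>n<N. c n *\<^sub>R unit_vec n)"
    by (simp add: norm_eval_combination)
qed

text \<open>Passing to the limit in the equation for finite combinations shows that coefficients of a norm convergent
  expansion are absolutely summable with sum the norm of the functional; uniqueness of
  expansions and the isometry with \<open>ell1\<close> both follow.\<close>

lemma eval_expansion_norm:
  assumes "(\<lambda>n. c n *\<^sub>R eval_functional n) sums f"
  shows "(\<lambda>n. \<bar>c n\<bar>) sums norm f"
  using tendsto_norm[OF assms[unfolded sums_def]] by (simp add: sums_def norm_eval_combination)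

lemma eval_expansion_unique:
  assumes "(\<lambda>n. c n *\<^sub>R eval_functional n) sums f" "(\<lambda>n. d n *\<^sub>R eval_functional n) sums f"
  shows "c = d"
proof -
  have "(\<lambda>n. (c n - d n) *\<^sub>R eval_functional n) sums (f - f)"
    using sums_diff[OF assms] by (simp add: scaleR_left_diff_distrib)
  then have "(\<lambda>n. \<bar>c n - d n\<bar>) sums 0"
    using eval_expansion_norm by fastforce
  then have "\<forall>n. \<bar>c n - d n\<bar> = 0"
    using suminf_eq_zero_iff[of "\<lambda>n. \<bar>c n - d n\<bar>"] by (simp add: sums_iff)
  then show ?thesis
    by auto
qed

lemma c0_unit_vectors: "\<exists>u. \<forall>k n. c0_entry (u k) n = (if n = k then 1 else 0)"
proof -
  have "\<exists>u. c0_entry u = (\<lambda>n. if n = k then 1 else 0)" for k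
  proof -
    have "(\<lambda>n. if n = k then 1 else 0 :: real) \<longlonglongrightarrow> 0"
      by (rule tendsto_eventually, rule eventually_sequentiallyI[of "Suc k"]) simp
    then show ?thesis
      using c0_of_sequence by blast
  qed
  then show ?thesis
    by metis
qed

lemma c0_functional:
  fixes g :: "c0 \<Rightarrow> real"
  assumes g: "bounded_linear g"
  obtains d where "summable (\<lambda>k. \<bar>d k\<bar>)" "\<And>c. (\<lambda>k. d k * c0_entry c k) sums g c"
proof -
  interpret g: bounded_linear g
    by (rule g)
  obtain u where u: "\<And>k n. c0_entry (u k) n = (if n = k then 1 else 0)"
    using c0_unit_vectors by blast
  have comb: "c0_entry (\<Sum>k<N. t k *\<^sub>R u k) n = (if n < N then t n else 0)" for t :: "nat \<Rightarrow> real" and N n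
    by (simp add: u mult_delta_right)
  define d where "d k = g (u k)" for k
  have "summable (\<lambda>k. \<bar>d k\<bar>)"
  proof (rule summableI_nonneg_bounded)
    fix N
    have "(\<Sum>k<N. \<bar>d k\<bar>) = g (\<Sum>k<N. sgn (d k) *\<^sub>R u k)"
      by (simp add: g.sum g.scaleR d_def[symmetric] abs_sgn mult.commute)
    also have "\<dots> \<le> norm (\<Sum>k<N. sgn (d k) *\<^sub>R u k) * onorm g"
      using onorm[OF g, of "\<Sum>k<N. sgn (d k) *\<^sub>R u k"] by (simp add: mult.commute)
    also have "\<dots> \<le> 1 * onorm g"
      by (intro mult_right_mono norm_c0_le onorm_pos_le[OF g]) (simp add: comb abs_sgn_eq del: c0_entry_sum)
    finally show "(\<Sum>k<N. \<bar>d k\<bar>) \<le> 1 * onorm g" .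
  qed simp
  moreover have "(\<lambda>k. d k * c0_entry c k) sums g c" for c
  proof -
    have "(\<lambda>k. c0_entry c k *\<^sub>R u k) sums c"
      unfolding sums_def
    proof (rule LIMSEQ_I)
      fix r :: real assume r: "0 < r"
      then obtain M where M: "\<And>n. n \<ge> M \<Longrightarrow> \<bar>c0_entry c n\<bar> < r / 2"
        using LIMSEQ_D[OF c0_entry_tendsto[of c], of "r / 2"] by auto
      have "norm ((\<Sum>k<N. c0_entry c k *\<^sub>R u k) - c) \<le> r / 2" if "N \<ge> M" for N
      proof (rule norm_c0_le)
        show "\<bar>c0_entry ((\<Sum>k<N. c0_entry c k *\<^sub>R u k) - c) n\<bar> \<le> r / 2" for n
          using M[of n] r that by (simp add: comb less_imp_le del: c0_entry_sum)
      qed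
      then show "\<exists>M. \<forall>N\<ge>M. norm ((\<Sum>k<N. c0_entry c k *\<^sub>R u k) - c) < r"
        using r by (intro exI[of _ M]) (force intro: le_less_trans)
    qed
    from g.sums[OF this] show ?thesis
      by (simp add: g.scaleR d_def mult.commute)
  qed
  ultimately show ?thesis
    using that by blast
qed

text \<open>Read through the isomorphism with \<open>c0\<close>, a functional sends \<open>x\<close> to \<open>d 0 * L + (\<Sum>k\<ge>1. d k * (x k - L))\<close>
  with \<open>d\<close> absolutely summable and \<open>L\<close> the limit of \<open>x\<close>.  Since \<open>L\<close> is itself the sum of the \<open>x n / 2 ^ (n + 1)\<close>,
  this is a combination of the entries.\<close>

lemma eval_expansion_exists:
  fixes f :: "X \<Rightarrow>\<^sub>L real"
  shows "\<exists>c. (\<lambda>n. c n *\<^sub>R eval_functional n) sums f"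
proof -
  have inv: "bounded_linear (inv to_c0)"
    using isomorphism_to_c0 by (simp add: isomorphism_def)
  have "bounded_linear (\<lambda>c. blinfun_apply f (inv to_c0 c))"
    by (rule bounded_linear_compose[OF blinfun.bounded_linear_right inv])
  then obtain d where d: "summable (\<lambda>k. \<bar>d k\<bar>)"
      "\<And>c. (\<lambda>k. d k * c0_entry c k) sums blinfun_apply f (inv to_c0 c)"
    using c0_functional by blast
  have fx: "(\<lambda>k. d k * c0_entry (to_c0 x) k) sums blinfun_apply f x" for x
    using d(2)[of "to_c0 x"] bij_to_c0 by (simp add: bij_is_inj)
  \<comment> \<open>The total coefficient of the limit \<open>L\<close>; it is spread over the entries by their weights.\<close>
  define E where "E = 2 * d 0 - (\<Sum>k. d k)"
  define d' where "d' k = (if k = 0 then 0 else d k)" for k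
  define c where "c n = d' n + E / 2 ^ (n + 1)" for n
  have d': "summable (\<lambda>k. \<bar>d' k\<bar>)"
    by (rule summable_comparison_test'[OF d(1)]) (simp add: d'_def)
  have "summable (\<lambda>n. \<bar>c n\<bar>)"
    unfolding c_def
  proof (rule summable_abs_add[OF d'])
    show "summable (\<lambda>n. \<bar>E / 2 ^ (n + 1)\<bar>)"
      using sums_summable[OF weights_sums[of "\<bar>E\<bar>"]] by simp
  qed
  have pointwise: "(\<lambda>n. c n * entry x n) sums blinfun_apply f x" for x
  proof -
    let ?L = "lim (entry x)"
    have "(\<lambda>k. d k * c0_entry (to_c0 x) k + (d k * ?L - (if k \<in> {0} then 2 * d k * ?L else 0))) sums
        (blinfun_apply f x + ((\<Sum>k. d k) * ?L - (\<Sum>k\<in>{0}. 2 * d k * ?L)))"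
      by (intro sums_add fx sums_diff sums_mult2 summable_sums summable_rabs_cancel[OF d(1)]
          sums_If_finite_set) simp
    moreover have "(\<lambda>n. E * (entry x n / 2 ^ (n + 1))) sums (E * ?L)"
      using entry_summable[of x] by (intro sums_mult) (simp add: entry_lim(2) summable_sums)
    ultimately have "(\<lambda>k. d k * c0_entry (to_c0 x) k + (d k * ?L - (if k \<in> {0} then 2 * d k * ?L else 0))
        + E * (entry x k / 2 ^ (k + 1))) sums
        (blinfun_apply f x + ((\<Sum>k. d k) * ?L - (\<Sum>k\<in>{0}. 2 * d k * ?L)) + E * ?L)"
      by (rule sums_add)
    also have "(\<lambda>k. d k * c0_entry (to_c0 x) k + (d k * ?L - (if k \<in> {0} then 2 * d k * ?L else 0))
        + E * (entry x k / 2 ^ (k + 1))) = (\<lambda>n. c n * entry x n)"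
    proof
      fix k
      show "d k * c0_entry (to_c0 x) k + (d k * ?L - (if k \<in> {0} then 2 * d k * ?L else 0))
          + E * (entry x k / 2 ^ (k + 1)) = c k * entry x k"
        by (cases k) (simp_all add: c_def d'_def to_c0_entry algebra_simps)
    qed
    also have "blinfun_apply f x + ((\<Sum>k. d k) * ?L - (\<Sum>k\<in>{0}. 2 * d k * ?L)) + E * ?L = blinfun_apply f x"
      by (simp add: E_def algebra_simps)
    finally show ?thesis .
  qed
  have "summable (\<lambda>n. norm (c n *\<^sub>R eval_functional n))"
    by (rule summable_comparison_test'[OF \<open>summable (\<lambda>n. \<bar>c n\<bar>)\<close>])
      (simp add: mult_left_le norm_eval_functional_le)
  then have sums: "(\<lambda>n. c n *\<^sub>R eval_functional n) sums (\<Sum>n. c n *\<^sub>R eval_functional n)"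
    by (rule summable_sums[OF summable_norm_cancel])
  have "(\<Sum>n. c n *\<^sub>R eval_functional n) = f"
  proof (rule blinfun_eqI)
    fix x
    have "(\<lambda>n. blinfun_apply (c n *\<^sub>R eval_functional n) x) sums
        blinfun_apply (\<Sum>n. c n *\<^sub>R eval_functional n) x"
      by (rule bounded_linear.sums[OF blinfun.bounded_linear_left sums])
    then show "blinfun_apply (\<Sum>n. c n *\<^sub>R eval_functional n) x = blinfun_apply f x"
      using pointwise[of x] by (auto simp: blinfun.scaleR_left dest: sums_unique2)
  qed
  with sums show ?thesis
    by metis
qed

lemma schauder_basis_eval: "schauder_basis eval_functional"
  unfolding schauder_basis_def using eval_expansion_exists eval_expansion_unique by blast

lemma dual_isometric_ell1: "\<exists>T :: (X \<Rightarrow>\<^sub>L real) \<Rightarrow> ell1. linear_isometry_onto T"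
proof -
  obtain c where c: "\<And>f. (\<lambda>n. c f n *\<^sub>R eval_functional n) sums f"
    using eval_expansion_exists by metis
  define T where "T f = Abs_ell1 (c f)" for f
  have Rep_T: "Rep_ell1 (T f) = c f" for f
    unfolding T_def using eval_expansion_norm[OF c[of f]] by (simp add: Abs_ell1_inverse sums_iff)
  have "linear T"
  proof (rule linearI)
    fix f g t
    have "(\<lambda>n. (c f n + c g n) *\<^sub>R eval_functional n) sums (f + g)"
      using sums_add[OF c[of f] c[of g]] by (simp add: scaleR_left_distrib)
    then have "c (f + g) = (\<lambda>n. c f n + c g n)"
      by (rule eval_expansion_unique[OF c])
    then show "T (f + g) = T f + T g"
      by (simp add: Rep_ell1_inject[symmetric] Rep_T plus_ell1.rep_eq)
    have "(\<lambda>n. (t * c f n) *\<^sub>R eval_functional n) sums (t *\<^sub>R f)"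
      using sums_scaleR_right[OF c[of f], of t] by simp
    then have "c (t *\<^sub>R f) = (\<lambda>n. t * c f n)"
      by (rule eval_expansion_unique[OF c])
    then show "T (t *\<^sub>R f) = t *\<^sub>R T f"
      by (simp add: Rep_ell1_inject[symmetric] Rep_T scaleR_ell1.rep_eq)
  qed
  moreover have "norm (T f) = norm f" for f
    using eval_expansion_norm[OF c[of f]] by (simp add: norm_ell1.rep_eq Rep_T sums_iff)
  moreover have "surj T"
    unfolding surj_def
  proof
    fix a
    have "summable (\<lambda>n. \<bar>Rep_ell1 a n\<bar>)"
      using Rep_ell1[of a] by simp
    then have "summable (\<lambda>n. norm (Rep_ell1 a n *\<^sub>R eval_functional n))"
      by (rule summable_comparison_test') (simp add: mult_left_le norm_eval_functional_le)
    then have "(\<lambda>n. Rep_ell1 a n *\<^sub>R eval_functional n) sums (\<Sum>n. Rep_ell1 a n *\<^sub>R eval_functional n)"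
      by (rule summable_sums[OF summable_norm_cancel])
    then have "c (\<Sum>n. Rep_ell1 a n *\<^sub>R eval_functional n) = Rep_ell1 a"
      by (rule eval_expansion_unique[OF c])
    then show "\<exists>f. a = T f"
      by (metis Rep_T Rep_ell1_inject)
  qed
  ultimately show ?thesis
    unfolding linear_isometry_onto_def by blast
qed

section \<open>Clopen sets in countable compact Hausdorff spaces\<close>

text \<open>Countable compact metric spaces and countable successor ordinals are both covered by countable
  compact Hausdorff spaces.\<close>

locale countable_compact =
  fixes K :: "'a topology"
  assumes compact: "compact_space K"
    and Hausdorff: "Hausdorff_space K"
    and countable: "countable (topspace K)"
begin

definition clopen :: "'a set \<Rightarrow> bool" where
  "clopen V \<longleftrightarrow> openin K V \<and> closedin K V"

lemma clopen_subset: "clopen V \<Longrightarrow> V \<subseteq> topspace K"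
  by (simp add: clopen_def openin_subset)

lemma clopen_space [simp]: "clopen (topspace K)" and clopen_empty [simp]: "clopen {}"
  by (simp_all add: clopen_def)

lemma clopen_Int: "clopen V \<Longrightarrow> clopen W \<Longrightarrow> clopen (V \<inter> W)"
  and clopen_Un: "clopen V \<Longrightarrow> clopen W \<Longrightarrow> clopen (V \<union> W)"
  and clopen_Diff: "clopen V \<Longrightarrow> clopen W \<Longrightarrow> clopen (V - W)"
  by (auto simp: clopen_def openin_diff closedin_diff)

lemma clopen_UN: "finite I \<Longrightarrow> (\<And>i. i \<in> I \<Longrightarrow> clopen (V i)) \<Longrightarrow> clopen (\<Union>i\<in>I. V i)"
  by (induction I rule: finite_induct) (auto intro: clopen_Un)

lemma continuous_indicator:
  assumes "clopen V"
  shows "continuous_map K euclideanreal (indicator V)"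
proof -
  have "openin K {x \<in> topspace K. indicator V x \<in> U}" for U :: "real set"
  proof -
    have "{x \<in> topspace K. indicator V x \<in> U} =
      (if 1 \<in> U then V else {}) \<union> (if 0 \<in> U then topspace K - V else {})"
      using clopen_subset[OF assms] by (auto simp: indicator_def split: if_splits)
    then show ?thesis
      using assms by (auto simp: clopen_def)
  qed
  then show ?thesis
    by (simp add: continuous_map)
qed

text \<open>A Urysohn function takes only countably many values, so some \<open>r\<close> strictly between \<open>0\<close> and \<open>1\<close> is
  omitted; its sublevel set at \<open>r\<close> is then both open and closed.\<close>

lemma clopen_base:
  assumes "openin K U" "x \<in> U"
  obtains V where "clopen V" "x \<in> V" "V \<subseteq> U"
proof -
  have x: "x \<in> topspace K"
    using assms openin_subset by blast
  have "normal_space K"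
    using compact Hausdorff by (simp add: compact_Hausdorff_or_regular_imp_normal_space)
  moreover have "closedin K {x}"
    using x Hausdorff by (simp add: closedin_Hausdorff_singleton)
  moreover have "closedin K (topspace K - U)" "disjnt {x} (topspace K - U)"
    using assms by (auto simp: disjnt_def)
  ultimately obtain f where f: "continuous_map K (top_of_set {0..1::real}) f"
      "f ` {x} \<subseteq> {0}" "f ` (topspace K - U) \<subseteq> {1}"
    using Urysohn_lemma[of K "{x}" "topspace K - U" 0 1] by auto
  then have cont: "continuous_map K euclideanreal f"
    by (simp add: continuous_map_in_subtopology)
  have "countable (f ` topspace K)"
    using countable by simp
  moreover have "uncountable {0<..<1::real}"
    by (simp add: uncountable_open_interval)
  ultimately obtain r where r: "0 < r" "r < 1" "r \<notin> f ` topspace K"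
    by (metis countable_subset greaterThanLessThan_iff subsetI)
  define V where "V = {y \<in> topspace K. f y \<in> {..<r}}"
  have "V = {y \<in> topspace K. f y \<in> {..r}}"
    using r unfolding V_def by (auto simp: less_le)
  then have "clopen V"
    using openin_continuous_map_preimage[OF cont, of "{..<r}"]
      closedin_continuous_map_preimage[OF cont, of "{..r}"]
    unfolding clopen_def V_def by auto
  moreover have "x \<in> V" "V \<subseteq> U"
    using f r x unfolding V_def by auto
  ultimately show ?thesis ..
qed

lemma clopen_avoiding:
  assumes "clopen U" "x \<in> U" "finite F" "x \<notin> F"
  obtains V where "clopen V" "x \<in> V" "V \<subseteq> U - F"
proof -
  have "closedin K (F \<inter> topspace K)"
    using assms Hausdorff by (simp add: closedin_Hausdorff_finite)
  then have "openin K (U - F \<inter> topspace K)"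
    using assms by (simp add: clopen_def openin_diff)
  then obtain V where V: "clopen V" "x \<in> V" "V \<subseteq> U - F \<inter> topspace K"
    using clopen_base[of "U - F \<inter> topspace K" x] assms by auto
  then have "V \<subseteq> U - F"
    using clopen_subset[OF V(1)] by blast
  with V show ?thesis
    using that by blast
qed

text \<open>A countable compact Hausdorff space is scattered.  If \<open>S\<close> had no isolated point, one could choose
  decreasing clopen sets meeting \<open>S\<close> that avoid the points of the space one after another; by
  compactness they have a common point, which is absurd.\<close>

lemma exists_isolated_point:
  assumes "S \<subseteq> topspace K" "S \<noteq> {}"
  obtains x V where "x \<in> S" "clopen V" "V \<inter> S = {x}"
proof (rule ccontr)
  note witness = that
  assume "\<not> thesis"
  then have *: "V \<inter> S \<noteq> {x}" if "clopen V" "x \<in> S" for x V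
    using witness that by blast
  define e where "e = from_nat_into (topspace K)"
  have "\<exists>V. \<forall>n. (clopen (V n) \<and> V n \<inter> S \<noteq> {}) \<and> (V (Suc n) \<subseteq> V n - {e n})"
  proof (rule dependent_nat_choice)
    show "\<exists>V. clopen V \<and> V \<inter> S \<noteq> {}"
      using assms by (intro exI[of _ "topspace K"]) auto
    fix V n assume V: "clopen V \<and> V \<inter> S \<noteq> {}"
    obtain p where p: "p \<in> V \<inter> S" "p \<noteq> e n"
      using V *[of V "e n"] by blast
    obtain W where "clopen W" "p \<in> W" "W \<subseteq> V - {e n}"
      using clopen_avoiding[of V p "{e n}"] V p by auto
    then show "\<exists>W. (clopen W \<and> W \<inter> S \<noteq> {}) \<and> W \<subseteq> V - {e n}"
      using p by blast
  qed
  then obtain V where V: "\<And>n. clopen (V n)" "\<And>n. V n \<inter> S \<noteq> {}" "\<And>n. V (Suc n) \<subseteq> V n - {e n}"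
    by blast
  have "(\<Inter>n. V n) \<noteq> {}"
  proof (rule compact_space_imp_nest[OF compact])
    show "closedin K (V n)" for n
      using V(1) by (simp add: clopen_def)
    show "V n \<noteq> {}" for n
      using V(2)[of n] by blast
    show "decseq V"
      using V(3) by (intro decseq_SucI) blast
  qed
  then obtain y where y: "\<And>n. y \<in> V n"
    by blast
  then have "y \<in> topspace K"
    using clopen_subset[OF V(1)] by blast
  then obtain n where "y = e n"
    unfolding e_def using countable by (metis from_nat_into_surj)
  then show False
    using y[of "Suc n"] V(3)[of n] by blast
qed

lemma continuous_cut:
  "\<lbrakk>continuous_map K euclideanreal f; clopen V\<rbrakk>
    \<Longrightarrow> continuous_map K euclideanreal (\<lambda>x. f x * indicator V x)"
  by (intro continuous_map_real_mult continuous_indicator)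

definition unit_ball :: "'a set \<Rightarrow> ('a \<Rightarrow> real) set" where
  "unit_ball V = {f. continuous_map K euclideanreal f \<and> (\<forall>y\<in>topspace K. \<bar>f y\<bar> \<le> 1) \<and>
                     (\<forall>y\<in>topspace K - V. f y = 0)}"

lemma unit_ball_continuous: "f \<in> unit_ball V \<Longrightarrow> continuous_map K euclideanreal f"
  by (simp add: unit_ball_def)

lemma unit_ball_mono: "f \<in> unit_ball V \<Longrightarrow> V \<subseteq> W \<Longrightarrow> f \<in> unit_ball W"
  by (auto simp: unit_ball_def)

lemma unit_ball_uminus: "f \<in> unit_ball V \<Longrightarrow> (\<lambda>x. - 1 * f x) \<in> unit_ball V"
  by (auto simp: unit_ball_def intro: continuous_map_minus)

lemma unit_ball_add:
  assumes "f \<in> unit_ball V" "g \<in> unit_ball W" "V \<inter> W = {}"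
  shows "(\<lambda>x. f x + g x) \<in> unit_ball (V \<union> W)"
proof -
  have "\<bar>f y + g y\<bar> \<le> 1" if "y \<in> topspace K" for y
    using assms that by (cases "y \<in> V"; cases "y \<in> W") (auto simp: unit_ball_def)
  then show ?thesis
    using assms by (auto simp: unit_ball_def intro: continuous_map_add)
qed

lemma indicator_unit_ball: "clopen V \<Longrightarrow> indicator V \<in> unit_ball V"
  using continuous_indicator by (auto simp: unit_ball_def indicator_def)

lemma continuous_bounded:
  assumes "continuous_map K euclideanreal f"
  obtains B where "0 < B" "\<And>x. x \<in> topspace K \<Longrightarrow> \<bar>f x\<bar> \<le> B"
proof -
  have "compact (f ` topspace K)"
    using image_compactin[of K "topspace K" euclideanreal f] assms compact
    by (simp add: compact_space_def)
  then obtain B where "0 < B" "\<forall>y\<in>f ` topspace K. norm y \<le> B"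
    using compact_imp_bounded bounded_pos by metis
  with that show ?thesis
    by auto
qed

end

section \<open>Functionals on continuous functions on a countable compact space\<close>

text \<open>Functionals on \<open>C(K)\<close> act here on real functions that are continuous on \<open>K\<close>, whatever their
  values off \<open>K\<close>; the bound forces the result to depend on the values on \<open>K\<close> only.\<close>

locale bounded_functional = countable_compact K for K :: "'a topology" +
  fixes \<Lambda> :: "('a \<Rightarrow> real) \<Rightarrow> real" and C :: real
  assumes add: "\<lbrakk>continuous_map K euclideanreal f; continuous_map K euclideanreal g\<rbrakk>
      \<Longrightarrow> \<Lambda> (\<lambda>x. f x + g x) = \<Lambda> f + \<Lambda> g"
    and scale: "continuous_map K euclideanreal f \<Longrightarrow> \<Lambda> (\<lambda>x. c * f x) = c * \<Lambda> f"
    and bound: "\<lbrakk>continuous_map K euclideanreal f; 0 \<le> B; \<And>x. x \<in> topspace K \<Longrightarrow> \<bar>f x\<bar> \<le> B\<rbrakk>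
      \<Longrightarrow> \<bar>\<Lambda> f\<bar> \<le> C * B"
begin

lemma C_nonneg: "0 \<le> C"
  using bound[of "\<lambda>_. 0" 1] by simp

lemma diff:
  assumes "continuous_map K euclideanreal f" "continuous_map K euclideanreal g"
  shows "\<Lambda> (\<lambda>x. f x - g x) = \<Lambda> f - \<Lambda> g"
  using add[OF assms(1), of "\<lambda>x. - 1 * g x"] scale[OF assms(2), of "- 1"] assms
  by simp

lemma cong:
  assumes "continuous_map K euclideanreal f" "continuous_map K euclideanreal g"
    "\<And>x. x \<in> topspace K \<Longrightarrow> f x = g x"
  shows "\<Lambda> f = \<Lambda> g"
  using bound[of "\<lambda>x. f x - g x" 0] diff[OF assms(1,2)] assms
  by (simp add: continuous_map_diff)

lemma sum:
  assumes "finite I" "\<And>i. i \<in> I \<Longrightarrow> continuous_map K euclideanreal (f i)"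
  shows "\<Lambda> (\<lambda>x. \<Sum>i\<in>I. f i x) = (\<Sum>i\<in>I. \<Lambda> (f i))"
  using assms
proof (induction I rule: finite_induct)
  case empty
  show ?case
    using scale[of "\<lambda>_. 0" 0] by simp
next
  case (insert i I)
  then show ?case
    by (simp add: add continuous_map_sum)
qed

lemma unit_ball_bound: "f \<in> unit_ball V \<Longrightarrow> \<bar>\<Lambda> f\<bar> \<le> C"
  using bound[of f 1] by (simp add: unit_ball_def)

text \<open>The variation of a functional on punctured neighbourhoods of a point tends to \<open>0\<close>.  Otherwise
  every neighbourhood \<open>V\<close> would carry an \<open>f\<close> in the unit ball, vanishing at \<open>x\<close>, with \<open>\<Lambda> f > \<epsilon>\<close>; cutting \<open>f\<close> off
  near \<open>x\<close>, where it is small, and repeating the choice closer to \<open>x\<close> gives functions with disjoint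
  supports.  A sum of \<open>n\<close> of them has norm at most \<open>1\<close> but value at least \<open>n * \<epsilon>\<close>.\<close>

lemma small_near_point:
  assumes x: "x \<in> topspace K" and \<epsilon>: "0 < \<epsilon>"
  obtains V where "clopen V" "x \<in> V" "\<And>f. f \<in> unit_ball V \<Longrightarrow> f x = 0 \<Longrightarrow> \<bar>\<Lambda> f\<bar> \<le> \<epsilon>"
proof (rule ccontr)
  note witness = that
  assume contra: "\<not> thesis"
  have step: "\<exists>W f. clopen W \<and> x \<in> W \<and> W \<subseteq> V \<and> f \<in> unit_ball (V - W) \<and> \<Lambda> f \<ge> \<epsilon>"
    if V: "clopen V" "x \<in> V" for V
  proof -
    obtain f0 where f0: "f0 \<in> unit_ball V" "f0 x = 0" "\<bar>\<Lambda> f0\<bar> > \<epsilon>"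
      using contra witness[OF V] by force
    obtain f where f: "f \<in> unit_ball V" "f x = 0" "\<Lambda> f > \<epsilon>"
    proof (cases "\<Lambda> f0 > \<epsilon>")
      case True
      with f0 show ?thesis
        using that by blast
    next
      case False
      with f0 scale[OF unit_ball_continuous[OF f0(1)], of "- 1"] show ?thesis
        using that[OF unit_ball_uminus[OF f0(1)]] by simp
    qed
    note fc = unit_ball_continuous[OF f(1)]
    define \<eta> where "\<eta> = (\<Lambda> f - \<epsilon>) / (C + 1)"
    have \<eta>: "0 < \<eta>" "C * \<eta> \<le> \<Lambda> f - \<epsilon>"
      using f(3) C_nonneg by (auto simp: \<eta>_def field_simps)
    have "openin K {y \<in> topspace K. f y \<in> {-\<eta><..<\<eta>}}"
      by (rule openin_continuous_map_preimage[OF fc]) simp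
    then have "openin K ({y \<in> topspace K. f y \<in> {-\<eta><..<\<eta>}} \<inter> V)"
      using V(1) by (intro openin_Int) (simp_all add: clopen_def)
    moreover have "x \<in> {y \<in> topspace K. f y \<in> {-\<eta><..<\<eta>}} \<inter> V"
      using x f(2) \<eta>(1) V(2) by simp
    ultimately obtain W where W: "clopen W" "x \<in> W" "W \<subseteq> {y \<in> topspace K. f y \<in> {-\<eta><..<\<eta>}} \<inter> V"
      by (rule clopen_base)
    let ?g = "\<lambda>y. f y * indicator W y"
    have "\<bar>\<Lambda> ?g\<bar> \<le> C * \<eta>"
      using W \<eta>(1) by (intro bound continuous_cut fc W(1)) (auto simp: indicator_def)
    then have "\<Lambda> (\<lambda>y. f y - ?g y) \<ge> \<epsilon>"
      using \<eta>(2) diff[OF fc continuous_cut[OF fc W(1)]] by simp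
    moreover have "(\<lambda>y. f y - ?g y) \<in> unit_ball (V - W)"
      using f(1) continuous_map_diff[OF fc continuous_cut[OF fc W(1)]]
      by (auto simp: unit_ball_def indicator_def)
    ultimately show ?thesis
      using W by blast
  qed
  have "\<exists>W f. clopen W \<and> x \<in> W \<and> f \<in> unit_ball (topspace K - W) \<and> \<Lambda> f \<ge> n * \<epsilon>" for n :: nat
  proof (induction n)
    case 0
    have "(\<lambda>_. 0) \<in> unit_ball (topspace K - topspace K)"
      by (simp add: unit_ball_def)
    moreover have "\<Lambda> (\<lambda>_. 0) = 0"
      using scale[of "\<lambda>_. 0" 0] by simp
    ultimately show ?case
      using x by (intro exI[of _ "topspace K"] exI[of _ "\<lambda>_. 0"]) auto
  next
    case (Suc n)
    then obtain V f where V: "clopen V" "x \<in> V" "f \<in> unit_ball (topspace K - V)" "\<Lambda> f \<ge> n * \<epsilon>"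
      by blast
    from step[OF V(1,2)] obtain W g where
      W: "clopen W" "x \<in> W" "W \<subseteq> V" "g \<in> unit_ball (V - W)" "\<Lambda> g \<ge> \<epsilon>"
      by blast
    have "(\<lambda>y. f y + g y) \<in> unit_ball (topspace K - W)"
      by (rule unit_ball_mono[OF unit_ball_add[OF V(3) W(4)]])
        (use W(3) clopen_subset[OF V(1)] in auto)
    moreover have "\<Lambda> (\<lambda>y. f y + g y) \<ge> Suc n * \<epsilon>"
      using V W by (simp add: add unit_ball_continuous distrib_right)
    ultimately show ?case
      using W by blast
  qed
  moreover obtain n :: nat where "C < n * \<epsilon>"
    using reals_Archimedean3[OF \<epsilon>] by blast
  ultimately obtain W f where "f \<in> unit_ball (topspace K - W)" "\<Lambda> f > C"
    by (meson less_le_trans)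
  then show False
    using unit_ball_bound by fastforce
qed

definition close_at :: "'a \<Rightarrow> real \<Rightarrow> real \<Rightarrow> 'a set \<Rightarrow> bool" where
  "close_at x a \<epsilon> V \<longleftrightarrow> clopen V \<and> x \<in> V \<and> (\<forall>f\<in>unit_ball V. \<bar>\<Lambda> f - a * f x\<bar> \<le> \<epsilon>)"

lemma close_at_subset:
  "close_at x a \<epsilon> V \<Longrightarrow> clopen W \<Longrightarrow> x \<in> W \<Longrightarrow> W \<subseteq> V \<Longrightarrow> close_at x a \<epsilon> W"
  using unit_ball_mono by (auto simp: close_at_def)

text \<open>The mass \<open>a\<close> of the point is the limit of the values at indicators of clopen neighbourhoods that
  shrink to \<open>x\<close>: by smallness on punctured neighbourhoods these values form a Cauchy sequence.\<close>

lemma exists_atom: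
  assumes x: "x \<in> topspace K"
  obtains a where "\<And>\<epsilon>. 0 < \<epsilon> \<Longrightarrow> \<exists>V. close_at x a \<epsilon> V"
proof -
  have "\<exists>V. clopen V \<and> x \<in> V \<and> (\<forall>f\<in>unit_ball V. f x = 0 \<longrightarrow> \<bar>\<Lambda> f\<bar> \<le> 1 / Suc n)" for n
    using small_near_point[OF x, of "1 / Suc n"] by (metis divide_pos_pos of_nat_0_less_iff zero_less_Suc zero_less_one)
  then obtain V where V: "\<And>n. clopen (V n)" "\<And>n. x \<in> V n"
      "\<And>n f. f \<in> unit_ball (V n) \<Longrightarrow> f x = 0 \<Longrightarrow> \<bar>\<Lambda> f\<bar> \<le> 1 / Suc n"
    by metis
  define m where "m n = \<Lambda> (indicator (V n))" for n
  have ind: "\<bar>\<Lambda> (indicator W) - m n\<bar> \<le> 1 / Suc n + 1 / Suc k"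
    if W: "clopen W" "x \<in> W" "W \<subseteq> V k" for W n k
  proof -
    have *: "\<bar>\<Lambda> (indicator A) - \<Lambda> (indicator (A \<inter> B))\<bar> \<le> 1 / Suc j"
      if "clopen A" "clopen B" "x \<in> A" "x \<in> B" "A \<subseteq> V j" for A B j
    proof -
      have "(\<lambda>y. indicator A y - indicator (A \<inter> B) y) \<in> unit_ball (V j)"
        using that continuous_map_diff[OF continuous_indicator continuous_indicator, OF that(1) clopen_Int[OF that(1,2)]]
        by (auto simp: unit_ball_def indicator_def)
      from V(3)[OF this] that show ?thesis
        by (simp add: diff continuous_indicator clopen_Int)
    qed
    show ?thesis
      using *[of W "V n" k] *[of "V n" W n] W V(1,2)[of n] unfolding m_def
      by (simp add: Int_commute)
  qed
  have "Cauchy m"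
  proof (rule CauchyI)
    fix e :: real assume "0 < e"
    then obtain N where N: "inverse (real (Suc N)) < e / 2"
      using reals_Archimedean[of "e / 2"] by auto
    have "norm (m i - m j) < e" if "i \<ge> N" "j \<ge> N" for i j
    proof -
      have "1 / Suc i \<le> inverse (Suc N)" "1 / Suc j \<le> inverse (Suc N)"
        using that by (auto simp: field_simps)
      then show ?thesis
        using ind[OF V(1,2) subset_refl, of i j] N unfolding m_def real_norm_def by linarith
    qed
    then show "\<exists>N. \<forall>i\<ge>N. \<forall>j\<ge>N. norm (m i - m j) < e"
      by blast
  qed
  then obtain a where a: "m \<longlonglongrightarrow> a"
    using real_Cauchy_convergent convergent_def by blast
  have "\<exists>V. close_at x a \<epsilon> V" if \<epsilon>: "0 < \<epsilon>" for \<epsilon>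
  proof -
    obtain N where "inverse (real (Suc N)) < \<epsilon> / 3"
      using reals_Archimedean[of "\<epsilon> / 3"] \<epsilon> by auto
    then have N: "1 / real (Suc N) < \<epsilon> / 3"
      by (simp add: inverse_eq_divide)
    have lim: "\<bar>\<Lambda> (indicator (V N)) - a\<bar> \<le> 0 + 1 / Suc N"
    proof (rule LIMSEQ_le)
      show "(\<lambda>n. \<bar>\<Lambda> (indicator (V N)) - m n\<bar>) \<longlonglongrightarrow> \<bar>\<Lambda> (indicator (V N)) - a\<bar>"
        by (intro tendsto_intros a)
      show "(\<lambda>n. 1 / Suc n + 1 / Suc N) \<longlonglongrightarrow> 0 + 1 / Suc N"
        using LIMSEQ_inverse_real_of_nat by (intro tendsto_intros) (simp add: inverse_eq_divide)
      show "\<exists>M. \<forall>n\<ge>M. \<bar>\<Lambda> (indicator (V N)) - m n\<bar> \<le> 1 / Suc n + 1 / Suc N"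
        using ind[OF V(1,2) subset_refl] by blast
    qed
    have "\<bar>\<Lambda> f - a * f x\<bar> \<le> \<epsilon>" if f: "f \<in> unit_ball (V N)" for f
    proof -
      note fc = unit_ball_continuous[OF f]
      have fx: "\<bar>f x\<bar> \<le> 1"
        using f x by (auto simp: unit_ball_def)
      \<comment> \<open>The difference has norm at most \<open>2\<close>, so it is halved to stay in the unit ball.\<close>
      let ?h = "\<lambda>y. 1/2 * (f y - f x * indicator (V N) y)"
      have hc: "continuous_map K euclideanreal (\<lambda>y. f x * indicator (V N) y)"
        using V(1) by (intro continuous_map_real_mult continuous_indicator) auto
      have "?h \<in> unit_ball (V N)"
      proof -
        have "continuous_map K euclideanreal ?h"
          by (intro continuous_map_real_mult continuous_map_diff fc hc) auto
        moreover have "\<bar>?h y\<bar> \<le> 1" if "y \<in> topspace K" for y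
          using f that fx by (auto simp: unit_ball_def indicator_def)
        ultimately show ?thesis
          using f by (auto simp: unit_ball_def indicator_def)
      qed
      from V(3)[OF this] have "\<bar>\<Lambda> ?h\<bar> \<le> 1 / Suc N"
        using V(2) by simp
      moreover have "\<Lambda> ?h = 1/2 * (\<Lambda> f - f x * \<Lambda> (indicator (V N)))"
        using scale[OF continuous_map_diff[OF fc hc], of "1/2"] diff[OF fc hc]
          scale[OF continuous_indicator[OF V(1)], of "f x" N] by simp
      ultimately have "\<bar>\<Lambda> f - f x * \<Lambda> (indicator (V N))\<bar> \<le> 2 * (1 / Suc N)"
        by simp
      moreover have "\<bar>f x * \<Lambda> (indicator (V N)) - f x * a\<bar> \<le> 1 * (1 / Suc N)"
        unfolding right_diff_distrib[symmetric] abs_mult using fx lim by (intro mult_mono) auto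
      ultimately show ?thesis
        using N unfolding mult.commute[of a] by linarith
    qed
    then show ?thesis
      using V by (auto simp: close_at_def)
  qed
  then show ?thesis
    using that by blast
qed

definition atom :: "'a \<Rightarrow> real" where
  "atom x = (SOME a. \<forall>\<epsilon>>0. \<exists>V. close_at x a \<epsilon> V)"

lemma atom:
  assumes "x \<in> topspace K" "0 < \<epsilon>"
  obtains V where "close_at x (atom x) \<epsilon> V"
proof -
  obtain a where "\<forall>\<epsilon>>0. \<exists>V. close_at x a \<epsilon> V"
    using exists_atom[OF assms(1)] by blast
  then have "\<forall>\<epsilon>>0. \<exists>V. close_at x (atom x) \<epsilon> V"
    unfolding atom_def by (rule someI)
  with assms that show ?thesis
    by blast
qed

text \<open>The masses of finitely many points are collected, with their signs, by one function in the unit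
  ball, because the points have disjoint clopen neighbourhoods.  This bounds the sum of the masses
  by the norm of the functional.\<close>

lemma sum_atoms_approx:
  assumes "finite F" "F \<subseteq> U" "clopen U" "0 < \<epsilon>"
  shows "\<exists>f\<in>unit_ball U. \<Lambda> f \<ge> (\<Sum>x\<in>F. \<bar>atom x\<bar>) - \<epsilon>"
  using assms
proof (induction F arbitrary: U \<epsilon> rule: finite_induct)
  case empty
  have "(\<lambda>_. 0) \<in> unit_ball U" "\<Lambda> (\<lambda>_. 0) = 0"
    using scale[of "\<lambda>_. 0" 0] by (simp_all add: unit_ball_def)
  then show ?case
    using empty by force
next
  case (insert x F)
  then have x: "x \<in> topspace K"
    using clopen_subset by blast
  obtain V where V: "close_at x (atom x) (\<epsilon>/2) V"
    using atom[OF x, of "\<epsilon>/2"] insert.prems by auto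
  have UV: "clopen (U \<inter> V)" "x \<in> U \<inter> V"
    using V insert.prems by (auto simp: close_at_def intro: clopen_Int)
  obtain W where W: "clopen W" "x \<in> W" "W \<subseteq> U \<inter> V - F"
    using clopen_avoiding[OF UV, of F] insert.hyps by blast
  have W': "close_at x (atom x) (\<epsilon>/2) W"
    using V W by (auto elim!: close_at_subset)
  have "F \<subseteq> U - W" "clopen (U - W)"
    using insert.prems W by (auto intro: clopen_Diff)
  then obtain f where f: "f \<in> unit_ball (U - W)" "\<Lambda> f \<ge> (\<Sum>x\<in>F. \<bar>atom x\<bar>) - \<epsilon>/2"
    using insert.IH[of "U - W" "\<epsilon>/2"] insert.prems by auto
  let ?g = "\<lambda>y. sgn (atom x) * indicator W y"
  have g: "?g \<in> unit_ball W"
    using indicator_unit_ball[OF W(1)] by (auto simp: unit_ball_def sgn_if intro: continuous_map_minus)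
  then have "\<bar>\<Lambda> ?g - atom x * ?g x\<bar> \<le> \<epsilon>/2"
    using W' unfolding close_at_def by blast
  then have "\<Lambda> ?g \<ge> \<bar>atom x\<bar> - \<epsilon>/2"
    using W(2) by (auto simp: sgn_if abs_if split: if_splits)
  then have "\<Lambda> (\<lambda>y. f y + ?g y) \<ge> (\<Sum>x\<in>insert x F. \<bar>atom x\<bar>) - \<epsilon>"
    using f(2) insert.hyps add[OF unit_ball_continuous[OF f(1)] unit_ball_continuous[OF g]] by simp
  moreover have "(\<lambda>y. f y + ?g y) \<in> unit_ball U"
    by (rule unit_ball_mono[OF unit_ball_add[OF f(1) g]]) (use W(3) in auto)
  ultimately show ?case
    by blast
qed

lemma sum_atoms_le:
  assumes "finite F" "F \<subseteq> topspace K"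
  shows "(\<Sum>x\<in>F. \<bar>atom x\<bar>) \<le> C"
proof (rule field_le_epsilon)
  fix \<epsilon> :: real assume "0 < \<epsilon>"
  then obtain f where "f \<in> unit_ball (topspace K)" "\<Lambda> f \<ge> (\<Sum>x\<in>F. \<bar>atom x\<bar>) - \<epsilon>"
    using sum_atoms_approx[OF assms clopen_space] by blast
  then show "(\<Sum>x\<in>F. \<bar>atom x\<bar>) \<le> C + \<epsilon>"
    using unit_ball_bound by fastforce
qed

lemma atoms_summable: "(\<lambda>x. \<bar>atom x\<bar>) summable_on topspace K"
proof (rule nonneg_bdd_above_summable_on)
  show "bdd_above (sum (\<lambda>x. \<bar>atom x\<bar>) ` {F. F \<subseteq> topspace K \<and> finite F})"
    using sum_atoms_le by (auto simp: bdd_above_def)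
qed simp

lemma infsum_atoms_le: "(\<Sum>\<^sub>\<infinity>x\<in>topspace K. \<bar>atom x\<bar>) \<le> C"
  by (intro infsum_le_finite_sums atoms_summable sum_atoms_le)

text \<open>Countability and compactness combine here: the \<open>n\<close>-th point receives a neighbourhood on which
  the functional is at most \<open>\<epsilon> / 2 ^ (n + 1)\<close>.  Finitely many of these cover the space, and cutting a function along the
  disjoint pieces of the cover bounds its value by \<open>\<epsilon>\<close>.\<close>

lemma local_zero_imp_zero:
  assumes loc: "\<And>x \<epsilon>. x \<in> topspace K \<Longrightarrow> 0 < \<epsilon> \<Longrightarrow>
      \<exists>V. clopen V \<and> x \<in> V \<and> (\<forall>f\<in>unit_ball V. \<bar>\<Lambda> f\<bar> \<le> \<epsilon>)"
    and f: "f \<in> unit_ball (topspace K)"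
  shows "\<Lambda> f = 0"
proof -
  note fc = unit_ball_continuous[OF f]
  have "\<bar>\<Lambda> f\<bar> \<le> \<epsilon>" if \<epsilon>: "0 < \<epsilon>" for \<epsilon>
  proof (cases "topspace K = {}")
    case True
    then show ?thesis
      using bound[OF fc, of 0] \<epsilon> by simp
  next
    case False
    define e where "e = from_nat_into (topspace K)"
    have e: "range e = topspace K"
      unfolding e_def using False countable by (simp add: range_from_nat_into)
    have "e n \<in> topspace K" "0 < \<epsilon> * (1/2) ^ Suc n" for n
      using e \<epsilon> by auto
    then have "\<exists>V. clopen V \<and> e n \<in> V \<and> (\<forall>f\<in>unit_ball V. \<bar>\<Lambda> f\<bar> \<le> \<epsilon> * (1/2) ^ Suc n)" for n
      by (rule loc)
    then obtain V where V: "\<And>n. clopen (V n)" "\<And>n. e n \<in> V n"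
        "\<And>n f. f \<in> unit_ball (V n) \<Longrightarrow> \<bar>\<Lambda> f\<bar> \<le> \<epsilon> * (1/2) ^ Suc n"
      by metis
    have "\<exists>\<F>. finite \<F> \<and> \<F> \<subseteq> range V \<and> topspace K \<subseteq> \<Union>\<F>"
    proof (rule compact[unfolded compact_space_alt, rule_format], intro conjI ballI)
      show "openin K U" if "U \<in> range V" for U
        using that V(1) by (auto simp: clopen_def)
      show "topspace K \<subseteq> \<Union>(range V)"
        unfolding e[symmetric] using V(2) by (intro image_subsetI UN_I) auto
    qed
    then obtain I where I: "finite I" "topspace K \<subseteq> (\<Union>n\<in>I. V n)"
      by (metis finite_subset_image)
    then obtain N where "I \<subseteq> {..<N}"
      using finite_nat_iff_bounded by blast
    with I have N: "topspace K \<subseteq> (\<Union>n<N. V n)"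
      by blast
    define A where "A n = disjointed V n" for n
    have A: "clopen (A n)" "A n \<subseteq> V n" for n
      unfolding A_def disjointed_def
      by (auto intro!: clopen_Diff clopen_UN V)
    have cut: "(\<lambda>x. f x * indicator (A n) x) \<in> unit_ball (V n)" for n
      using f continuous_cut[OF fc A(1)] A(2)[of n] by (auto simp: unit_ball_def indicator_def)
    have "\<Lambda> f = \<Lambda> (\<lambda>x. \<Sum>n<N. f x * indicator (A n) x)"
    proof (rule cong[OF fc])
      show "continuous_map K euclideanreal (\<lambda>x. \<Sum>n<N. f x * indicator (A n) x)"
        by (intro continuous_map_sum unit_ball_continuous[OF cut]) auto
      fix x assume "x \<in> topspace K"
      then have "x \<in> (\<Union>n<N. A n)"
        using N finite_UN_disjointed_eq[of V N] by (auto simp: A_def lessThan_atLeast0)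
      then obtain n where n: "n < N" "x \<in> A n"
        by blast
      have "indicator (A k) x = (if k = n then 1 else 0 :: real)" for k
        using n disjoint_family_disjointed[of V] 
        by (auto simp: A_def disjoint_family_on_def indicator_def)
      then show "f x = (\<Sum>n<N. f x * indicator (A n) x)"
        using n by (simp add: mult_delta_right)
    qed
    also have "\<dots> = (\<Sum>n<N. \<Lambda> (\<lambda>x. f x * indicator (A n) x))"
      by (intro sum unit_ball_continuous[OF cut]) auto
    also have "\<bar>\<dots>\<bar> \<le> (\<Sum>n<N. \<epsilon> * (1/2) ^ Suc n)"
      by (intro order_trans[OF sum_abs] sum_mono V(3) cut)
    also have "\<dots> \<le> (\<Sum>n. \<epsilon> * (1/2) ^ Suc n)"
      using \<epsilon> sums_summable[OF power_half_series] by (intro sum_le_suminf summable_mult) auto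
    also have "\<dots> = \<epsilon>"
      using sums_unique[OF sums_mult[OF power_half_series, of \<epsilon>]] by simp
    finally show ?thesis .
  qed
  then show ?thesis
    by (metis abs_le_zero_iff dense_ge)
qed

lemma weighted_sum:
  assumes f: "continuous_map K euclideanreal f" and B: "\<And>x. x \<in> topspace K \<Longrightarrow> \<bar>f x\<bar> \<le> B"
  shows "(\<lambda>x. atom x * f x) summable_on topspace K"
    and "\<bar>\<Sum>\<^sub>\<infinity>x\<in>topspace K. atom x * f x\<bar> \<le> (\<Sum>\<^sub>\<infinity>x\<in>topspace K. \<bar>atom x\<bar>) * B"
proof -
  have sB: "(\<lambda>x. \<bar>atom x\<bar> * B) summable_on topspace K"
    by (intro summable_on_cmult_left atoms_summable)
  have le: "\<bar>atom x * f x\<bar> \<le> \<bar>atom x\<bar> * B" if "x \<in> topspace K" for x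
    using B[OF that] by (simp add: abs_mult mult_left_mono)
  have s: "(\<lambda>x. \<bar>atom x * f x\<bar>) summable_on topspace K"
    by (rule summable_on_comparison_test[OF sB]) (use le in auto)
  then show "(\<lambda>x. atom x * f x) summable_on topspace K"
    using summable_on_iff_abs_summable_on_real by fastforce
  have "\<bar>\<Sum>\<^sub>\<infinity>x\<in>topspace K. atom x * f x\<bar> \<le> (\<Sum>\<^sub>\<infinity>x\<in>topspace K. \<bar>atom x * f x\<bar>)"
    using norm_infsum_bound[of "\<lambda>x. atom x * f x" "topspace K"] s by simp
  also have "\<dots> \<le> (\<Sum>\<^sub>\<infinity>x\<in>topspace K. \<bar>atom x\<bar> * B)"
    by (rule infsum_mono[OF s sB le])
  finally show "\<bar>\<Sum>\<^sub>\<infinity>x\<in>topspace K. atom x * f x\<bar> \<le> (\<Sum>\<^sub>\<infinity>x\<in>topspace K. \<bar>atom x\<bar>) * B"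
    by (simp add: infsum_cmult_left')
qed

lemma weighted_summable:
  "continuous_map K euclideanreal f \<Longrightarrow> (\<lambda>x. atom x * f x) summable_on topspace K"
  using continuous_bounded weighted_sum(1) by metis

text \<open>This is \<open>C(K)* = l_1(K)\<close> for countable \<open>K\<close>, the form that the Riesz theorem takes when every measure
  is atomic.  Subtracting the atomic part leaves a functional \<open>\<psi>\<close> that is small near each point, hence
  zero.\<close>

lemma representation:
  assumes f: "continuous_map K euclideanreal f"
  shows "\<Lambda> f = (\<Sum>\<^sub>\<infinity>x\<in>topspace K. atom x * f x)"
proof -
  define \<psi> where "\<psi> f = \<Lambda> f - (\<Sum>\<^sub>\<infinity>x\<in>topspace K. atom x * f x)" for f
  interpret \<psi>: bounded_functional K \<psi> "C + C"
  proof
    fix f g c assume f: "continuous_map K euclideanreal f"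
    show "\<psi> (\<lambda>x. c * f x) = c * \<psi> f"
      by (simp add: \<psi>_def scale f mult.left_commute infsum_cmult_right' right_diff_distrib)
    show "\<psi> (\<lambda>x. f x + g x) = \<psi> f + \<psi> g" if g: "continuous_map K euclideanreal g"
      using infsum_add[OF weighted_summable[OF f] weighted_summable[OF g]]
      by (simp add: \<psi>_def add f g distrib_left)
    fix B :: real assume B: "0 \<le> B" "\<And>x. x \<in> topspace K \<Longrightarrow> \<bar>f x\<bar> \<le> B"
    have "\<bar>\<psi> f\<bar> \<le> \<bar>\<Lambda> f\<bar> + \<bar>\<Sum>\<^sub>\<infinity>x\<in>topspace K. atom x * f x\<bar>"
      unfolding \<psi>_def by (rule abs_triangle_ineq4)
    also have "\<dots> \<le> C * B + C * B"
      using bound[OF f B] weighted_sum(2)[OF f B(2)] mult_right_mono[OF infsum_atoms_le B(1)]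
      by linarith
    finally show "\<bar>\<psi> f\<bar> \<le> (C + C) * B"
      by (simp only: distrib_right)
  qed
  have zero: "\<psi> f = 0" if "f \<in> unit_ball (topspace K)" for f
  proof (rule \<psi>.local_zero_imp_zero[OF _ that])
    fix x and \<epsilon> :: real assume x: "x \<in> topspace K" and \<epsilon>: "0 < \<epsilon>"
    let ?s = "\<lambda>A. \<Sum>\<^sub>\<infinity>x\<in>A. \<bar>atom x\<bar>"
    obtain V where V: "close_at x (atom x) (\<epsilon>/2) V"
      using atom[OF x, of "\<epsilon>/2"] \<epsilon> by auto
    obtain F where F: "finite F" "F \<subseteq> topspace K"
        "dist (\<Sum>x\<in>F. \<bar>atom x\<bar>) (?s (topspace K)) \<le> \<epsilon>/2"
      using infsum_finite_approximation[OF atoms_summable, of "\<epsilon>/2"] \<epsilon> by auto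
    define G where "G = insert x F"
    have G: "finite G" "G \<subseteq> topspace K" "x \<in> G"
      using F x by (auto simp: G_def)
    have split: "infsum h (topspace K) = infsum h (topspace K - G) + sum h G"
      if "h summable_on topspace K" for h :: "'a \<Rightarrow> real"
      using infsum_Diff[OF that, of G] G by (simp add: summable_on_finite)
    have "(\<Sum>x\<in>F. \<bar>atom x\<bar>) \<le> (\<Sum>x\<in>G. \<bar>atom x\<bar>)"
      using G by (intro sum_mono2) (auto simp: G_def)
    then have tail: "?s (topspace K - G) \<le> \<epsilon>/2"
      using split[OF atoms_summable] F(3) unfolding dist_real_def by linarith
    \<comment> \<open>Outside \<open>G\<close> the masses are small in total, and \<open>W\<close> meets \<open>G\<close> in \<open>x\<close> alone.\<close>
    obtain W where W: "clopen W" "x \<in> W" "W \<subseteq> V - (G - {x})"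
      using clopen_avoiding[of V x "G - {x}"] V G by (auto simp: close_at_def)
    have "\<bar>\<psi> f\<bar> \<le> \<epsilon>" if f: "f \<in> unit_ball W" for f
    proof -
      note fc = unit_ball_continuous[OF f]
      have sG: "(\<lambda>y. \<bar>atom y\<bar>) summable_on (topspace K - G)"
        using atoms_summable by (rule summable_on_subset) auto
      have le: "\<bar>atom y * f y\<bar> \<le> \<bar>atom y\<bar>" if "y \<in> topspace K" for y
        using f that by (auto simp: unit_ball_def abs_mult intro: mult_left_le)
      have "\<bar>\<Sum>\<^sub>\<infinity>y\<in>topspace K - G. atom y * f y\<bar> \<le> ?s (topspace K - G)"
        using norm_infsum_le[OF has_sum_infsum[OF summable_on_subset[OF weighted_summable[OF fc]]]
            has_sum_infsum[OF sG], of] le by fastforce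
      moreover have "(\<Sum>y\<in>G. atom y * f y) = atom x * f x"
      proof -
        have "f y = 0" if "y \<in> G - {x}" for y
          using f that W(3) G(2) by (auto simp: unit_ball_def)
        then show ?thesis
          using sum.remove[OF G(1,3), of "\<lambda>y. atom y * f y"] by simp
      qed
      moreover have "\<bar>\<Lambda> f - atom x * f x\<bar> \<le> \<epsilon>/2"
        using V unit_ball_mono[OF f, of V] W(3) by (auto simp: close_at_def)
      ultimately show ?thesis
        using split[OF weighted_summable[OF fc]] tail unfolding \<psi>_def by linarith
    qed
    then show "\<exists>V. clopen V \<and> x \<in> V \<and> (\<forall>f\<in>unit_ball V. \<bar>\<psi> f\<bar> \<le> \<epsilon>)"
      using W by blast
  qed
  obtain B where B: "0 < B" "\<And>x. x \<in> topspace K \<Longrightarrow> \<bar>f x\<bar> \<le> B"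
    using continuous_bounded[OF f] by blast
  have "continuous_map K euclideanreal (\<lambda>x. inverse B * f x)"
    by (intro continuous_map_real_mult f) simp
  then have "(\<lambda>x. inverse B * f x) \<in> unit_ball (topspace K)"
    using B by (simp add: unit_ball_def abs_mult field_simps)
  then have "\<psi> f = 0"
    using zero \<psi>.scale[OF f, of "inverse B"] B(1) by fastforce
  then show ?thesis
    by (simp add: \<psi>_def)
qed

end

section \<open>Quotients of spaces of continuous functions\<close>

text \<open>This is what the argument uses of a quotient map onto an isometric copy of \<open>X\<close>: it is a linear
  contraction under which vectors have lifts of almost the same norm.\<close>

definition metric_surjection_on ::
    "'z::real_normed_vector set \<Rightarrow> ('z \<Rightarrow> 'x::real_normed_vector) \<Rightarrow> bool" where
  "metric_surjection_on Z q \<longleftrightarrow>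
     (\<forall>z\<in>Z. \<forall>w\<in>Z. q (z + w) = q z + q w) \<and> (\<forall>c. \<forall>z\<in>Z. q (c *\<^sub>R z) = c *\<^sub>R q z) \<and>
     (\<forall>z\<in>Z. norm (q z) \<le> norm z) \<and> (\<forall>x \<epsilon>. 0 < \<epsilon> \<longrightarrow> (\<exists>z\<in>Z. q z = x \<and> norm z < norm x + \<epsilon>))"

text \<open>The map sends \<open>z\<close> to the vector corresponding to its coset.  An isometry in the given sense is
  injective, since \<open>T x\<close> determines the norm of \<open>x - y\<close> through sums and multiples of cosets.\<close>

lemma metric_surjection_onto_quotient:
  fixes T :: "'x::real_normed_vector \<Rightarrow> 'z::real_normed_vector set"
  assumes Z: "subspace Z" and Y: "closed_subspace_of Y Z" and T: "isometry_onto_quotient T Z Y"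
  obtains q :: "'z \<Rightarrow> 'x" where "metric_surjection_on Z q"
proof -
  have Ysub: "subspace Y" and YZ: "Y \<subseteq> Z"
    using Y closedin_subset by (fastforce simp: closed_subspace_of_def)+
  have range: "range T = cosets Z Y"
    and T_add: "T (x + y) = T x + T y"
    and T_scale: "T (c *\<^sub>R x) = coset_scale Y c (T x)"
    and T_norm: "quotient_norm (T x) = norm x" for x y c
    using T by (auto simp: isometry_onto_quotient_def)
  have mem: "a \<in> z +o Y \<longleftrightarrow> a - z \<in> Y" for a z
    by (auto simp: elt_set_plus_def intro!: bexI[of _ "a - z"])
  have bdd: "bdd_below (norm ` (A :: 'z set))" for A
    by (rule bdd_belowI2[of _ 0]) simp
  have inj: "x = y" if "T x = T y" for x y
  proof -
    have "T (x + (- 1) *\<^sub>R y) = T (x + (- 1) *\<^sub>R x)"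
      using that by (simp only: T_add T_scale)
    then have "norm (x + (- 1) *\<^sub>R y) = norm (x + (- 1) *\<^sub>R x)"
      by (metis T_norm)
    then show ?thesis
      by simp
  qed
  define q where "q z = inv T (z +o Y)" for z
  have Tq: "T (q z) = z +o Y" if "z \<in> Z" for z
    unfolding q_def using range that by (intro f_inv_into_f) (simp add: cosets_def)
  have qI: "q z = x" if "z \<in> Z" "T x = z +o Y" for z x
    using Tq[OF that(1)] that(2) inj by metis
  have "metric_surjection_on Z q"
    unfolding metric_surjection_on_def
  proof (intro conjI ballI allI impI)
    fix z w c assume z: "z \<in> Z"
    show "q (z + w) = q z + q w" if w: "w \<in> Z"
    proof (rule qI)
      have "(z +o Y) + (w +o Y) = (z + w) +o Y"
      proof (intro set_eqI iffI)
        fix a assume "a \<in> (z +o Y) + (w +o Y)"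
        then obtain y y' where "y \<in> Y" "y' \<in> Y" "a = z + y + (w + y')"
          by (auto simp: set_plus_def elt_set_plus_def)
        then show "a \<in> (z + w) +o Y"
          using subspace_add[OF Ysub, of y y'] by (simp add: mem algebra_simps)
      next
        fix a assume "a \<in> (z + w) +o Y"
        then have "a - w \<in> z +o Y" "w \<in> w +o Y"
          using subspace_0[OF Ysub] by (simp_all add: mem algebra_simps)
        then show "a \<in> (z +o Y) + (w +o Y)"
          using set_plus_intro[of "a - w" "z +o Y" w "w +o Y"] by simp
      qed
      then show "T (q z + q w) = (z + w) +o Y"
        by (simp add: T_add Tq z w)
    qed (use z w Z in \<open>simp add: subspace_add\<close>)
    show "q (c *\<^sub>R z) = c *\<^sub>R q z"
    proof (rule qI)
      have "coset_scale Y c (z +o Y) = (c *\<^sub>R z) +o Y"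
      proof (intro set_eqI iffI)
        fix a assume "a \<in> coset_scale Y c (z +o Y)"
        then obtain y y' where "y \<in> Y" "y' \<in> Y" "a = c *\<^sub>R (z + y) + y'"
          by (auto simp: coset_scale_def set_plus_def elt_set_plus_def)
        then show "a \<in> (c *\<^sub>R z) +o Y"
          using subspace_add[OF Ysub subspace_scale[OF Ysub, of y c], of y']
          by (simp add: mem algebra_simps)
      next
        fix a assume "a \<in> (c *\<^sub>R z) +o Y"
        then have "a - c *\<^sub>R z \<in> Y" "c *\<^sub>R z \<in> (\<lambda>a. c *\<^sub>R a) ` (z +o Y)"
          using subspace_0[OF Ysub] by (auto simp: mem)
        then show "a \<in> coset_scale Y c (z +o Y)"
          unfolding coset_scale_def
          using set_plus_intro[of "c *\<^sub>R z" "(\<lambda>a. c *\<^sub>R a) ` (z +o Y)" "a - c *\<^sub>R z" Y] by simp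
      qed
      then show "T (c *\<^sub>R q z) = (c *\<^sub>R z) +o Y"
        by (simp add: T_scale Tq z)
    qed (use z Z in \<open>simp add: subspace_scale\<close>)
    have "norm (q z) = (INF a\<in>z +o Y. norm a)"
      using T_norm[of "q z"] by (simp add: Tq z quotient_norm_def)
    also have "\<dots> \<le> norm z"
      using subspace_0[OF Ysub] by (intro cINF_lower bdd) (simp add: mem)
    finally show "norm (q z) \<le> norm z" .
  next
    fix x and \<epsilon> :: real assume \<epsilon>: "0 < \<epsilon>"
    have "T x \<in> cosets Z Y"
      using range by blast
    then obtain z where z: "z \<in> Z" "T x = z +o Y"
      by (auto simp: cosets_def)
    have "z \<in> z +o Y"
      using subspace_0[OF Ysub] by (simp add: mem)
    moreover have "(INF a\<in>z +o Y. norm a) < norm x + \<epsilon>"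
      using T_norm[of x] z(2) \<epsilon> by (simp add: quotient_norm_def)
    ultimately obtain a where a: "a \<in> z +o Y" "norm a < norm x + \<epsilon>"
      using cINF_less_iff[OF _ bdd, of "z +o Y"] by (metis empty_iff)
    have "a = z + (a - z)"
      by simp
    then have aZ: "a \<in> Z"
      using a(1) z(1) YZ subspace_add[OF Z, of z "a - z"] by (auto simp: mem)
    have "a +o Y = z +o Y"
    proof (intro set_eqI)
      fix b
      have "b - z \<in> Y" if "b - a \<in> Y"
        using subspace_add[OF Ysub that, of "a - z"] a(1) by (simp add: mem)
      moreover have "b - a \<in> Y" if "b - z \<in> Y"
        using subspace_diff[OF Ysub that, of "a - z"] a(1) by (simp add: mem)
      ultimately show "b \<in> a +o Y \<longleftrightarrow> b \<in> z +o Y"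
        unfolding mem by blast
    qed
    then show "\<exists>z\<in>Z. q z = x \<and> norm z < norm x + \<epsilon>"
      using qI[OF aZ, of x] z(2) aZ a(2) by auto
  qed
  then show ?thesis
    by (rule that)
qed

lemma subspace_C_space: "subspace (C_space K)"
  unfolding subspace_def C_space_def
  by (auto simp: plus_bcontfun.rep_eq scaleR_bcontfun.rep_eq
      intro: continuous_map_add continuous_map_real_mult)

lemma bcontfun_discrete_eqI:
  fixes f g :: "'b discrete \<Rightarrow>\<^sub>C real"
  shows "(\<And>x. apply_bcontfun f (discrete x) = apply_bcontfun g (discrete x)) \<Longrightarrow> f = g"
  by (rule bcontfun_eqI) (metis of_discrete_inverse)

context countable_compact
begin

definition extend :: "('a \<Rightarrow> real) \<Rightarrow> 'a discrete \<Rightarrow>\<^sub>C real" where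
  "extend f = Bcontfun (\<lambda>d. if of_discrete d \<in> topspace K then f (of_discrete d) else 0)"

lemma extend_apply:
  assumes "continuous_map K euclideanreal f"
  shows "apply_bcontfun (extend f) (discrete x) = (if x \<in> topspace K then f x else 0)"
proof -
  obtain B where B: "0 < B" "\<And>x. x \<in> topspace K \<Longrightarrow> \<bar>f x\<bar> \<le> B"
    using continuous_bounded[OF assms] by blast
  let ?h = "\<lambda>d. if of_discrete d \<in> topspace K then f (of_discrete d) else 0"
  have "continuous_on UNIV ?h"
    by (simp add: continuous_on_open_vimage open_discrete)
  moreover have "bounded (range ?h)"
    by (rule boundedI[of _ B]) (use B in auto)
  ultimately have "?h \<in> bcontfun"
    by (simp add: bcontfun_def)
  then show ?thesis
    by (simp add: extend_def Bcontfun_inverse discrete_inverse)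
qed

lemma norm_extend_le:
  assumes "continuous_map K euclideanreal f" "0 \<le> B" "\<And>x. x \<in> topspace K \<Longrightarrow> \<bar>f x\<bar> \<le> B"
  shows "norm (extend f) \<le> B"
proof (rule norm_bound)
  fix d :: "'a discrete"
  obtain x where "d = discrete x"
    by (metis of_discrete_inverse)
  then show "norm (apply_bcontfun (extend f) d) \<le> B"
    using assms by (simp add: extend_apply)
qed

lemma extend_in_C_space:
  assumes "continuous_map K euclideanreal f"
  shows "extend f \<in> C_space K"
  using continuous_map_eq[OF assms] by (simp add: C_space_def extend_apply[OF assms])

lemma extend_add:
  assumes "continuous_map K euclideanreal f" "continuous_map K euclideanreal g"
  shows "extend (\<lambda>x. f x + g x) = extend f + extend g"
  by (rule bcontfun_discrete_eqI)
    (simp add: plus_bcontfun.rep_eq extend_apply assms continuous_map_add)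

lemma extend_scale:
  assumes "continuous_map K euclideanreal f"
  shows "extend (\<lambda>x. c * f x) = c *\<^sub>R extend f"
  by (rule bcontfun_discrete_eqI)
    (simp add: scaleR_bcontfun.rep_eq extend_apply assms continuous_map_real_mult)

lemma extend_restriction:
  assumes "z \<in> C_space K"
  shows "continuous_map K euclideanreal (\<lambda>x. apply_bcontfun z (discrete x))"
    "extend (\<lambda>x. apply_bcontfun z (discrete x)) = z"
proof -
  show *: "continuous_map K euclideanreal (\<lambda>x. apply_bcontfun z (discrete x))"
    using assms by (simp add: C_space_def)
  show "extend (\<lambda>x. apply_bcontfun z (discrete x)) = z"
    by (rule bcontfun_discrete_eqI) (use assms in \<open>simp add: extend_apply[OF *] C_space_def\<close>)
qed

text \<open>If \<open>q\<close> were such a quotient map, the functionals \<open>\<phi> n f = entry (q f) n\<close> would have atomic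
  representations \<open>a n\<close>.  Lifting elements of \<open>X\<close> with entries \<open>1\<close> and \<open>\<plusminus>1\<close> in places \<open>n\<close> and \<open>m\<close> shows that
  \<open>a n \<plusminus> a m\<close> have \<open>l_1\<close>-norm \<open>2\<close>, which forces the supports to be disjoint.  At an isolated point \<open>x\<close> of
  the union of the supports, charged by \<open>a k\<close>, the indicator of a clopen \<open>V\<close> isolating \<open>x\<close> maps to an
  element of \<open>X\<close> whose only nonzero entry is the \<open>k\<close>-th.  Its limit is \<open>0\<close>, its weighted sum is not.\<close>

lemma X_not_isometric_to_quotient: "\<not> isometric_to_quotient_of TYPE(X) (C_space K)"
proof
  assume "isometric_to_quotient_of TYPE(X) (C_space K)"
  then obtain Y and T :: "X \<Rightarrow> ('a discrete \<Rightarrow>\<^sub>C real) set"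
    where "closed_subspace_of Y (C_space K)" "isometry_onto_quotient T (C_space K) Y"
    unfolding isometric_to_quotient_of_def by blast
  with subspace_C_space obtain q :: "('a discrete \<Rightarrow>\<^sub>C real) \<Rightarrow> X"
    where q: "metric_surjection_on (C_space K) q"
    by (rule metric_surjection_onto_quotient)
  have
    q_add: "\<And>z w. z \<in> C_space K \<Longrightarrow> w \<in> C_space K \<Longrightarrow> q (z + w) = q z + q w"
    and q_scale: "\<And>c z. z \<in> C_space K \<Longrightarrow> q (c *\<^sub>R z) = c *\<^sub>R q z"
    and q_norm: "\<And>z. z \<in> C_space K \<Longrightarrow> norm (q z) \<le> norm z"
    and q_lift: "\<And>x \<epsilon>. 0 < \<epsilon> \<Longrightarrow> \<exists>z\<in>C_space K. q z = x \<and> norm z < norm x + \<epsilon>"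
    using q unfolding metric_surjection_on_def by simp_all
  define \<phi> where "\<phi> n f = entry (q (extend f)) n" for n f
  have functional: "bounded_functional K (\<phi> n) 1" for n
  proof unfold_locales
    fix f g c assume f: "continuous_map K euclideanreal f"
    show "\<phi> n (\<lambda>x. f x + g x) = \<phi> n f + \<phi> n g" if g: "continuous_map K euclideanreal g"
      by (simp add: \<phi>_def extend_add[OF f g] q_add extend_in_C_space f g)
    show "\<phi> n (\<lambda>x. c * f x) = c * \<phi> n f"
      by (simp add: \<phi>_def extend_scale[OF f] q_scale extend_in_C_space f)
    fix B :: real assume B: "0 \<le> B" "\<And>x. x \<in> topspace K \<Longrightarrow> \<bar>f x\<bar> \<le> B"
    have "\<bar>\<phi> n f\<bar> \<le> norm (q (extend f))"
      unfolding \<phi>_def by (rule abs_entry_le)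
    also have "\<dots> \<le> norm (extend f)"
      by (rule q_norm[OF extend_in_C_space[OF f]])
    also have "\<dots> \<le> B"
      by (rule norm_extend_le[OF f B])
    finally show "\<bar>\<phi> n f\<bar> \<le> 1 * B"
      by simp
  qed
  define a where "a n = bounded_functional.atom K (\<phi> n)" for n
  note rep = bounded_functional.representation[OF functional, folded a_def]
    and a_summable = bounded_functional.atoms_summable[OF functional, folded a_def]
    and a_le = bounded_functional.infsum_atoms_le[OF functional, folded a_def]
    and a_weighted = bounded_functional.weighted_summable[OF functional, folded a_def]
  have sum_summable: "(\<lambda>x. \<bar>a n x + \<sigma> * a m x\<bar>) summable_on topspace K"
    if "\<bar>\<sigma>\<bar> = 1" for n m \<sigma>
    by (rule summable_on_comparison_test[OF summable_on_add[OF a_summable[of n] a_summable[of m]]])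
      (use that abs_triangle_ineq[of "a n _" "\<sigma> * a m _"] in \<open>simp_all add: abs_mult\<close>)
  have far: "2 \<le> (\<Sum>\<^sub>\<infinity>x\<in>topspace K. \<bar>a n x + \<sigma> * a m x\<bar>)" (is "2 \<le> ?S")
    if nm: "n \<noteq> m" and \<sigma>: "\<bar>\<sigma>\<bar> = 1" for n m \<sigma>
  proof (rule ccontr)
    assume less: "\<not> 2 \<le> ?S"
    \<comment> \<open>Any \<open>\<epsilon>\<close> with \<open>?S * (1 + \<epsilon>) < 2\<close> will do; as \<open>?S < 2\<close>, this one does.\<close>
    define \<epsilon> where "\<epsilon> = (2 - ?S) / 3"
    have \<epsilon>: "0 < \<epsilon>"
      using less by (simp add: \<epsilon>_def)
    have "\<bar>if i = m then \<sigma> else 1\<bar> \<le> 1" for i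
      using \<sigma> by simp
    then obtain x where x: "\<And>i. i < Suc (max n m) \<Longrightarrow> entry x i = (if i = m then \<sigma> else 1)" "norm x \<le> 1"
      using X_extending_prefix[of "Suc (max n m)" "\<lambda>i. if i = m then \<sigma> else 1"] by blast
    obtain z where z: "z \<in> C_space K" "q z = x" "norm z < norm x + \<epsilon>"
      using q_lift[OF \<epsilon>] by blast
    define f where "f x = apply_bcontfun z (discrete x)" for x
    have f: "continuous_map K euclideanreal f" "extend f = z"
      using extend_restriction[OF z(1)] by (simp_all add: f_def[abs_def])
    have fb: "\<bar>f x\<bar> \<le> 1 + \<epsilon>" for x
      using norm_bounded[of z "discrete x"] z(3) x(2) by (simp add: f_def)
    have "\<phi> n f + \<sigma> * \<phi> m f = 2"
      using x(1)[of n] x(1)[of m] nm \<sigma> by (auto simp: \<phi>_def f z abs_if split: if_splits)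
    moreover have "\<phi> n f + \<sigma> * \<phi> m f = (\<Sum>\<^sub>\<infinity>x\<in>topspace K. a n x * f x + \<sigma> * (a m x * f x))"
      using infsum_add[OF a_weighted[OF f(1), of n] summable_on_cmult_right[OF a_weighted[OF f(1), of m]], of \<sigma>]
      by (simp add: rep[OF f(1)] infsum_cmult_right')
    ultimately have two: "2 = (\<Sum>\<^sub>\<infinity>x\<in>topspace K. a n x * f x + \<sigma> * (a m x * f x))"
      by simp
    have "norm (\<Sum>\<^sub>\<infinity>x\<in>topspace K. a n x * f x + \<sigma> * (a m x * f x)) \<le> ?S * (1 + \<epsilon>)"
    proof (rule norm_infsum_le)
      show "((\<lambda>x. a n x * f x + \<sigma> * (a m x * f x)) has_sum
          (\<Sum>\<^sub>\<infinity>x\<in>topspace K. a n x * f x + \<sigma> * (a m x * f x))) (topspace K)"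
        by (intro has_sum_infsum summable_on_add summable_on_cmult_right a_weighted f)
      show "((\<lambda>x. \<bar>a n x + \<sigma> * a m x\<bar> * (1 + \<epsilon>)) has_sum ?S * (1 + \<epsilon>)) (topspace K)"
        by (intro has_sum_cmult_left has_sum_infsum sum_summable \<sigma>)
      show "norm (a n x * f x + \<sigma> * (a m x * f x)) \<le> \<bar>a n x + \<sigma> * a m x\<bar> * (1 + \<epsilon>)" for x
        using mult_left_mono[OF fb[of x], of "\<bar>a n x + \<sigma> * a m x\<bar>"]
        by (simp add: abs_mult[symmetric] algebra_simps)
    qed
    then have "2 \<le> ?S * (1 + \<epsilon>)"
      unfolding two[symmetric] by simp
    also have "\<dots> \<le> ?S + 2 * \<epsilon>"
      using less \<epsilon> by (simp add: distrib_left mult_right_mono)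
    also have "\<dots> < 2"
      using less by (simp add: \<epsilon>_def field_simps)
    finally show False
      by simp
  qed
  have extremal: "\<bar>a n x + \<sigma> * a m x\<bar> = \<bar>a n x\<bar> + \<bar>a m x\<bar>"
    if nm: "n \<noteq> m" and \<sigma>: "\<bar>\<sigma>\<bar> = 1" and x: "x \<in> topspace K" for n m \<sigma> x
  proof -
    let ?h = "\<lambda>x. (\<bar>a n x\<bar> + \<bar>a m x\<bar>) - \<bar>a n x + \<sigma> * a m x\<bar>"
    have h: "(?h has_sum ((\<Sum>\<^sub>\<infinity>x\<in>topspace K. \<bar>a n x\<bar>) + (\<Sum>\<^sub>\<infinity>x\<in>topspace K. \<bar>a m x\<bar>)
        - (\<Sum>\<^sub>\<infinity>x\<in>topspace K. \<bar>a n x + \<sigma> * a m x\<bar>))) (topspace K)"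
    proof -
      have "((\<lambda>x. - \<bar>a n x + \<sigma> * a m x\<bar>) has_sum
          - (\<Sum>\<^sub>\<infinity>x\<in>topspace K. \<bar>a n x + \<sigma> * a m x\<bar>)) (topspace K)"
        by (simp only: has_sum_uminus minus_minus has_sum_infsum sum_summable[OF \<sigma>])
      from has_sum_add[OF has_sum_add[OF has_sum_infsum has_sum_infsum, OF a_summable a_summable] this]
      show ?thesis
        by (simp only: diff_conv_add_uminus)
    qed
    have "?h x = 0"
    proof (rule nonneg_has_sum_le_0D[OF h _ _ x])
      show "(\<Sum>\<^sub>\<infinity>x\<in>topspace K. \<bar>a n x\<bar>) + (\<Sum>\<^sub>\<infinity>x\<in>topspace K. \<bar>a m x\<bar>)
          - (\<Sum>\<^sub>\<infinity>x\<in>topspace K. \<bar>a n x + \<sigma> * a m x\<bar>) \<le> 0"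
        using a_le[of n] a_le[of m] far[OF nm \<sigma>] by linarith
      show "0 \<le> ?h y" for y
        using abs_triangle_ineq[of "a n y" "\<sigma> * a m y"] \<sigma> by (simp add: abs_mult)
    qed
    then show ?thesis
      by simp
  qed
  have disjoint: "a n x = 0 \<or> a m x = 0" if nm: "n \<noteq> m" and x: "x \<in> topspace K" for n m x
  proof -
    have "\<bar>a n x + a m x\<bar> = \<bar>a n x\<bar> + \<bar>a m x\<bar>" "\<bar>a n x - a m x\<bar> = \<bar>a n x\<bar> + \<bar>a m x\<bar>"
      using extremal[OF nm _ x, of 1] extremal[OF nm _ x, of "- 1"] by simp_all
    then show ?thesis
      by linarith
  qed
  define S where "S = {x \<in> topspace K. \<exists>n. a n x \<noteq> 0}"
  have "S \<noteq> {}"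
  proof
    assume "S = {}"
    then have "(\<Sum>\<^sub>\<infinity>x\<in>topspace K. \<bar>a 0 x + 1 * a 1 x\<bar>) = (\<Sum>\<^sub>\<infinity>x\<in>topspace K. 0)"
      by (intro infsum_cong) (auto simp: S_def)
    with far[of 0 1 1] show False
      by simp
  qed
  moreover have "S \<subseteq> topspace K"
    by (auto simp: S_def)
  ultimately obtain x V where xV: "x \<in> S" "clopen V" "V \<inter> S = {x}"
    using exists_isolated_point by metis
  then obtain k where k: "a k x \<noteq> 0" and x: "x \<in> topspace K"
    by (auto simp: S_def)
  define w where "w = q (extend (indicator V))"
  have "entry w n = (if n = k then a k x else 0)" for n
  proof -
    have "entry w n = (\<Sum>\<^sub>\<infinity>y\<in>topspace K. a n y * indicator V y)"
      using rep[OF continuous_indicator[OF xV(2)], of n] by (simp add: \<phi>_def w_def)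
    also have "\<dots> = (\<Sum>\<^sub>\<infinity>y\<in>{x}. a n y)"
    proof (rule infsum_cong_neutral)
      fix y assume "y \<in> topspace K - {x}"
      then have "y \<notin> V \<or> a n y = 0"
        using xV(3) by (auto simp: S_def)
      then show "a n y * indicator V y = 0"
        by (auto simp: indicator_def)
    qed (use x xV(3) in \<open>auto simp: indicator_def\<close>)
    also have "\<dots> = (if n = k then a k x else 0)"
      using disjoint[of n k x] k x by auto
    finally show ?thesis .
  qed
  then have w: "entry w = (\<lambda>n. if n = k then a k x else 0)"
    by blast
  have "entry w \<longlonglongrightarrow> 0"
    unfolding w by (rule tendsto_eventually, rule eventually_sequentiallyI[of "Suc k"]) simp
  then have "(\<Sum>n. entry w n / 2 ^ (n + 1)) = 0"
    by (rule LIMSEQ_unique[OF entry_tendsto])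
  moreover have "(\<Sum>n. entry w n / 2 ^ (n + 1)) = (\<Sum>n\<in>{k}. entry w n / 2 ^ (n + 1))"
    by (rule suminf_finite) (auto simp: w)
  ultimately show False
    using k by (simp add: w)
qed
end

section \<open>Metric spaces and ordinals\<close>

lemma openin_order_topology_ray:
  assumes "a \<in> S"
  shows "openin (order_topology_on S) {x \<in> S. x < a}" "openin (order_topology_on S) {x \<in> S. a < x}"
  using assms unfolding order_topology_on_def by (auto intro!: topology_generated_by_Basis)

lemma topspace_order_topology [simp]: "topspace (order_topology_on S) = S"
  unfolding order_topology_on_def by auto

lemma Hausdorff_order_topology:
  fixes S :: "'a::order set"
  assumes lin: "\<And>x y. x \<in> S \<Longrightarrow> y \<in> S \<Longrightarrow> x \<le> y \<or> y \<le> x"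
  shows "Hausdorff_space (order_topology_on S)"
proof -
  have sep: "\<exists>U V. openin (order_topology_on S) U \<and> openin (order_topology_on S) V \<and>
      a \<in> U \<and> b \<in> V \<and> disjnt U V" if ab: "a \<in> S" "b \<in> S" "a < b" for a b
  proof (cases "\<exists>c\<in>S. a < c \<and> c < b")
    case True
    then obtain c where c: "c \<in> S" "a < c" "c < b"
      by blast
    show ?thesis
      by (rule exI[of _ "{x \<in> S. x < c}"], rule exI[of _ "{x \<in> S. c < x}"])
        (use ab c openin_order_topology_ray[of c S] in \<open>auto simp: disjnt_iff\<close>)
  next
    case False
    have "disjnt {x \<in> S. x < b} {x \<in> S. a < x}"
      using False by (auto simp: disjnt_iff)
    then show ?thesis
      using ab openin_order_topology_ray[of _ S]
      by (intro exI[of _ "{x \<in> S. x < b}"] exI[of _ "{x \<in> S. a < x}"]) auto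
  qed
  have "a < b \<or> b < a" if "a \<in> S" "b \<in> S" "a \<noteq> b" for a b
    using lin[OF that(1,2)] that(3) by (auto simp: less_le)
  then show ?thesis
    unfolding Hausdorff_space_def topspace_order_topology using sep
    by (metis disjnt_sym)
qed

text \<open>Only neighbourhoods to the left matter for the compactness of a well-order; the first alternative
  covers the least element and open sets that contain everything below \<open>a\<close>.\<close>

lemma order_topology_left_nbhd:
  fixes S :: "'a::order set"
  assumes lin: "\<And>x y. x \<in> S \<Longrightarrow> y \<in> S \<Longrightarrow> x \<le> y \<or> y \<le> x"
    and U: "openin (order_topology_on S) U" and a: "a \<in> U"
  shows "(\<forall>y\<in>S. y \<le> a \<longrightarrow> y \<in> U) \<or> (\<exists>c\<in>S. c < a \<and> (\<forall>y\<in>S. c < y \<and> y \<le> a \<longrightarrow> y \<in> U))"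
proof -
  have "generate_topology_on ({S} \<union> (\<lambda>a. {x \<in> S. x < a}) ` S \<union> (\<lambda>a. {x \<in> S. a < x}) ` S) U"
    using U unfolding order_topology_on_def by (rule openin_topology_generated_by)
  then show ?thesis
    using a
  proof induction
    case Empty
    then show ?case by simp
  next
    case (Int A B)
    have A: "(\<forall>y\<in>S. y \<le> a \<longrightarrow> y \<in> A) \<or> (\<exists>c\<in>S. c < a \<and> (\<forall>y\<in>S. c < y \<and> y \<le> a \<longrightarrow> y \<in> A))"
      and B: "(\<forall>y\<in>S. y \<le> a \<longrightarrow> y \<in> B) \<or> (\<exists>c\<in>S. c < a \<and> (\<forall>y\<in>S. c < y \<and> y \<le> a \<longrightarrow> y \<in> B))"
      using Int by auto
    show ?case
    proof (cases "\<exists>c d. c \<in> S \<and> d \<in> S \<and> c < a \<and> d < a \<and> (\<forall>y\<in>S. c < y \<and> y \<le> a \<longrightarrow> y \<in> A) \<and>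
        (\<forall>y\<in>S. d < y \<and> y \<le> a \<longrightarrow> y \<in> B)")
      case True
      then obtain c d where cd: "c \<in> S" "d \<in> S" "c < a" "d < a"
          "\<forall>y\<in>S. c < y \<and> y \<le> a \<longrightarrow> y \<in> A" "\<forall>y\<in>S. d < y \<and> y \<le> a \<longrightarrow> y \<in> B"
        by blast
      from lin[OF cd(1,2)] show ?thesis
      proof
        assume "c \<le> d"
        then have "\<forall>y\<in>S. d < y \<and> y \<le> a \<longrightarrow> y \<in> A \<inter> B"
          using cd(5,6) by (auto intro: le_less_trans)
        with cd show ?thesis by blast
      next
        assume "d \<le> c"
        then have "\<forall>y\<in>S. c < y \<and> y \<le> a \<longrightarrow> y \<in> A \<inter> B"
          using cd(5,6) by (auto intro: le_less_trans)
        with cd show ?thesis by blast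
      qed
    next
      case False
      with A B show ?thesis
        by (metis IntI)
    qed
  next
    case (UN \<K>)
    then obtain A where "A \<in> \<K>" "a \<in> A"
      by blast
    then show ?case
      using UN.IH[of A] by blast
  next
    case (Basis s)
    then consider "s = S" | b where "b \<in> S" "s = {x \<in> S. x < b}" | b where "b \<in> S" "s = {x \<in> S. b < x}"
      by blast
    then show ?case
    proof cases
      case 3
      then show ?thesis using Basis(2) by blast
    qed (use Basis(2) in \<open>auto intro: le_less_trans\<close>)
  qed
qed

text \<open>The least point \<open>m\<close> whose closed initial segment is not finitely covered would lie in a member of the
  cover that contains everything below \<open>m\<close> or a left neighbourhood \<open>{c<..m}\<close>, and the segment up to \<open>c\<close> is finitely covered.\<close>

lemma compact_order_topology:
  fixes S :: "'a::order set"
  assumes lin: "\<And>x y. x \<in> S \<Longrightarrow> y \<in> S \<Longrightarrow> x \<le> y \<or> y \<le> x"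
    and wf: "\<And>A. A \<subseteq> S \<Longrightarrow> A \<noteq> {} \<Longrightarrow> \<exists>m\<in>A. \<forall>x\<in>A. m \<le> x"
    and top: "t \<in> S" "\<And>x. x \<in> S \<Longrightarrow> x \<le> t"
  shows "compact_space (order_topology_on S)"
  unfolding compact_space_alt topspace_order_topology
proof (intro allI impI)
  fix \<U> assume \<U>: "(\<forall>U\<in>\<U>. openin (order_topology_on S) U) \<and> S \<subseteq> \<Union>\<U>"
  define good where "good a \<longleftrightarrow> (\<exists>\<F>. finite \<F> \<and> \<F> \<subseteq> \<U> \<and> {x \<in> S. x \<le> a} \<subseteq> \<Union>\<F>)" for a
  have "good a" if "a \<in> S" for a
  proof (rule ccontr)
    assume "\<not> good a"
    with that wf[of "{x \<in> S. \<not> good x}"] obtain m where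
      m: "m \<in> S" "\<not> good m" "\<And>x. x \<in> S \<Longrightarrow> \<not> good x \<Longrightarrow> m \<le> x"
      by auto
    obtain U where U: "U \<in> \<U>" "m \<in> U"
      using m(1) \<U> by blast
    then consider "\<forall>y\<in>S. y \<le> m \<longrightarrow> y \<in> U"
      | c where "c \<in> S" "c < m" "\<forall>y\<in>S. c < y \<and> y \<le> m \<longrightarrow> y \<in> U"
      using order_topology_left_nbhd[where S = S and U = U and a = m, OF lin] \<U> by auto
    then have "good m"
    proof cases
      case 1
      then show ?thesis
        unfolding good_def using U by (intro exI[of _ "{U}"]) auto
    next
      case (2 c)
      then have "good c"
        using m(3)[of c] by (auto dest: less_le_not_le[THEN iffD1])
      then obtain \<F> where \<F>: "finite \<F>" "\<F> \<subseteq> \<U>" "{x \<in> S. x \<le> c} \<subseteq> \<Union>\<F>"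
        unfolding good_def by blast
      have "{x \<in> S. x \<le> m} \<subseteq> \<Union>(insert U \<F>)"
      proof
        fix x assume x: "x \<in> {x \<in> S. x \<le> m}"
        then have "x \<le> c \<or> c < x"
          using lin[of x c] 2(1) by (auto simp: less_le)
        then show "x \<in> \<Union>(insert U \<F>)"
          using x 2(3) \<F>(3) by blast
      qed
      then show ?thesis
        unfolding good_def using \<F> U by (intro exI[of _ "insert U \<F>"]) auto
    qed
    with m(2) show False ..
  qed
  from this[OF top(1)] show "\<exists>\<F>. finite \<F> \<and> \<F> \<subseteq> \<U> \<and> S \<subseteq> \<Union>\<F>"
    unfolding good_def using top(2) by (metis (no_types, lifting) mem_Collect_eq subset_eq)
qed

text \<open>Every initial segment is the whole field or the set of strict predecessors of a point.  This gives
  countability, and the least element of a family of segments is its intersection: if that were not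
  a member, it would consist of the strict predecessors of some \<open>x\<close>, and \<open>x\<close> would lie in every member.\<close>

lemma countable_compact_ordinals_upto:
  assumes r: "Well_order r" and countable: "countable (Field r)"
  shows "countable_compact (ordinals_upto r)"
proof -
  interpret wo_rel r
    using r by (simp add: wo_rel_def)
  let ?S = "{A. ofilter A}"
  have lin: "A \<subseteq> B \<or> B \<subseteq> A" if "A \<in> ?S" "B \<in> ?S" for A B
    using that ofilter_linord by auto
  have form: "A = Field r \<or> (\<exists>x\<in>Field r. A = underS x)" if "ofilter A" for A
    using that ofilter_underS_Field by blast
  have least: "\<exists>M\<in>\<A>. \<forall>A\<in>\<A>. M \<subseteq> A" if \<A>: "\<A> \<subseteq> ?S" "\<A> \<noteq> {}" for \<A>
  proof (rule ccontr)
    assume none: "\<not> (\<exists>M\<in>\<A>. \<forall>A\<in>\<A>. M \<subseteq> A)"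
    have "ofilter (\<Inter>\<A>)"
      using \<A> unfolding ofilter_def by blast
    moreover obtain B where B: "B \<in> \<A>"
      using \<A> by blast
    then have "B \<subseteq> Field r"
      using \<A> unfolding ofilter_def by blast
    with B none have "\<Inter>\<A> \<noteq> Field r"
      by (metis Inter_lower Inter_greatest subset_antisym)
    ultimately obtain x where x: "x \<in> Field r" "\<Inter>\<A> = underS x"
      using form by blast
    have "x \<in> A" if A: "A \<in> \<A>" for A
    proof -
      have "\<not> A \<subseteq> \<Inter>\<A>"
        using none A by (metis Inter_lower subset_trans)
      then obtain y where y: "y \<in> A" "y \<notin> underS x"
        using x by blast
      have oA: "ofilter A"
        using A \<A> by auto
      then have "y \<in> Field r"
        using y unfolding ofilter_def by blast
      then have "(x, y) \<in> r"
        using y(2) x(1) TOTALS unfolding underS_def by blast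
      then show "x \<in> A"
        using oA y(1) unfolding ofilter_def under_def by blast
    qed
    then show False
      using x by (auto simp: underS_def)
  qed
  have "compact_space (order_topology_on ?S)"
  proof (rule compact_order_topology[where t = "Field r", OF lin least])
    show "Field r \<in> ?S"
      using Field_ofilter by simp
    show "A \<subseteq> Field r" if "A \<in> ?S" for A
      using that by (simp add: ofilter_def)
  qed
  moreover have "Hausdorff_space (order_topology_on ?S)"
    by (rule Hausdorff_order_topology[OF lin])
  moreover have "?S \<subseteq> insert (Field r) (underS ` Field r)"
    using form by blast
  then have "countable ?S"
    using countable by (meson countable_image countable_insert countable_subset)
  ultimately show ?thesis
    unfolding ordinals_upto_def by unfold_locales simp_all
qed

lemma countable_compact_mtopology_of:
  assumes "compact_space (mtopology_of K)" "countable (mspace K)"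
  shows "countable_compact (mtopology_of K)"
proof -
  have "Hausdorff_space (mtopology_of K)"
    by (simp add: mtopology_of_def Metric_space.Hausdorff_space_mtopology[OF Metric_space_mspace_mdist])
  with assms show ?thesis
    by unfold_locales simp_all
qed

theorem mainTheorem1:
  shows
    "(\<exists>T :: X \<Rightarrow> c0. isomorphism T) \<and>
     (\<exists>T :: (X \<Rightarrow>\<^sub>L real) \<Rightarrow> ell1. linear_isometry_onto T) \<and>
     schauder_basis eval_functional \<and>
     isometrically_equivalent eval_functional unit_vec \<and>
     (\<forall>K :: 'k metric. compact_space (mtopology_of K) \<and> countable (mspace K) \<longrightarrow>
        \<not> isometric_to_quotient_of TYPE(X) (C_space (mtopology_of K))) \<and>
     (\<forall>r :: 'o rel. Well_order r \<and> countable (Field r) \<longrightarrow>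
        \<not> isometric_to_quotient_of TYPE(X) (C_space (ordinals_upto r)))"
  using isomorphism_to_c0 dual_isometric_ell1 schauder_basis_eval isometrically_equivalent_eval
    countable_compact.X_not_isometric_to_quotient[OF countable_compact_mtopology_of]
    countable_compact.X_not_isometric_to_quotient[OF countable_compact_ordinals_upto]
  by blast

end
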